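(* For every integer $N\geq 1$, $B_0(N,2)=\varepsilon_0(N-1,2)=(N-1)\cdot 4^{N-2}$.
   Context: Let $N\ge 1$, $K\ge 1$. A gluing datum with $N$ edges and $K$ faces consists of a composition $(m_1,\dots,m_K)$ of $2N$ into positive integers and a fixed-point-free involution $\iota$ of $\{1,\dots,2N\}$. With $s_0=0$, $s_i=m_1+\dots+m_i$, let $\tau$ have cycles $(s_{i-1}+1,\dots,s_i)$. The datum is connected if $\langle\iota,\tau\rangle$ is transitive, and has genus $g$ if $\tau\iota$ has $N-K+2-2g$ cycles. $\varepsilon_g(N,K)$ is the number of connected genus-$g$ data; $\varepsilon_g(0,K)=0$ for $g+K>1$. The datum is bicolored if every $m_i$ is even and $\iota$ maps each element $s_{i-1}+r$ with $r$ odd to an element $s_{j-1}+r'$ with $r'$ even. $B_g(N,K)$ is the number of connected bicolored genus-$g$ data with $N$ edges and $K$ faces. (Geometrically these count gluings of polygons into a closed orientable surface of genus $g$, resp. gluings of properly black/white vertex-colored polygons respecting colors, with distinguished edges starting at white vertices.) For $N=1$ the right-hand side $(N-1)4^{N-2}$ equals $0$. *)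

theory Defs
  imports "HOL-Combinatorics.Combinatorics" "HOL-Algebra.Sym_Groups"
begin

definition compositions :: "nat \<Rightarrow> nat \<Rightarrow> nat list set" where
  "compositions n K = {ms. length ms = K \<and> (\<forall>m\<in>set ms. 0 < m) \<and> sum_list ms = n}"

text \<open>Lists are indexed from 0, so face number \<open>i < length ms\<close> occupies the labels
  \<open>psum ms i + 1, \<dots>, psum ms (Suc i)\<close>.\<close>

definition psum :: "nat list \<Rightarrow> nat \<Rightarrow> nat" where
  "psum ms i = sum_list (take i ms)"

definition face_cycle :: "nat list \<Rightarrow> nat \<Rightarrow> nat \<Rightarrow> nat" where
  "face_cycle ms i = cycle_of_list [psum ms i + 1..<psum ms (Suc i) + 1]"

definition face_perm :: "nat list \<Rightarrow> nat \<Rightarrow> nat" where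
  "face_perm ms = foldr (\<lambda>i p. face_cycle ms i \<circ> p) [0..<length ms] id"

definition fpf_involution :: "nat \<Rightarrow> (nat \<Rightarrow> nat) \<Rightarrow> bool" where
  "fpf_involution n \<iota> \<longleftrightarrow>
     \<iota> permutes {1..n} \<and> \<iota> \<circ> \<iota> = id \<and> (\<forall>x\<in>{1..n}. \<iota> x \<noteq> x)"

definition gluing_data :: "nat \<Rightarrow> nat \<Rightarrow> (nat list \<times> (nat \<Rightarrow> nat)) set" where
  "gluing_data N K = {(ms, \<iota>). ms \<in> compositions (2 * N) K \<and> fpf_involution (2 * N) \<iota>}"

definition connected_datum :: "nat \<Rightarrow> nat list \<Rightarrow> (nat \<Rightarrow> nat) \<Rightarrow> bool" where
  "connected_datum N ms \<iota> \<longleftrightarrow>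
     (\<forall>x\<in>{1..2 * N}. \<forall>y\<in>{1..2 * N}.
        \<exists>p\<in>generate (sym_group (2 * N)) {\<iota>, face_perm ms}. p x = y)"

text \<open>Fixed points of \<open>p\<close> in \<open>{1..n}\<close> count as cycles.\<close>

definition num_cycles :: "nat \<Rightarrow> (nat \<Rightarrow> nat) \<Rightarrow> nat" where
  "num_cycles n p = card (orbit p ` {1..n})"

definition has_genus :: "nat \<Rightarrow> nat \<Rightarrow> nat \<Rightarrow> nat list \<Rightarrow> (nat \<Rightarrow> nat) \<Rightarrow> bool" where
  "has_genus g N K ms \<iota> \<longleftrightarrow>
     int (num_cycles (2 * N) (face_perm ms \<circ> \<iota>)) = int N - int K + 2 - 2 * int g"

definition bicolored :: "nat list \<Rightarrow> (nat \<Rightarrow> nat) \<Rightarrow> bool" where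
  "bicolored ms \<iota> \<longleftrightarrow>
     (\<forall>m\<in>set ms. even m) \<and>
     (\<forall>i<length ms. \<forall>r\<in>{1..ms ! i}. odd r \<longrightarrow>
        (\<exists>j<length ms. \<exists>r'\<in>{1..ms ! j}. even r' \<and> \<iota> (psum ms i + r) = psum ms j + r'))"

text \<open>For \<open>N = 0\<close> and \<open>g + K \<le> 1\<close> the value is the usual convention that a single
  vertex on the sphere counts as one gluing.\<close>

definition eps :: "nat \<Rightarrow> nat \<Rightarrow> nat \<Rightarrow> nat" where
  "eps g N K =
     (if N = 0 then (if g + K > 1 then 0 else 1)
      else card {(ms, \<iota>). (ms, \<iota>) \<in> gluing_data N K \<and>
             connected_datum N ms \<iota> \<and> has_genus g N K ms \<iota>})"

definition bicolored_count :: "nat \<Rightarrow> nat \<Rightarrow> nat \<Rightarrow> nat" where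
  "bicolored_count g N K =
     card {(ms, \<iota>). (ms, \<iota>) \<in> gluing_data N K \<and> connected_datum N ms \<iota> \<and>
             has_genus g N K ms \<iota> \<and> bicolored ms \<iota>}"

end

theory Submission
  imports Defs "HOL-Computational_Algebra.Formal_Power_Series"
begin

text \<open>Deleting the edge \<open>{a, x}\<close> of a gluing \<open>(\<tau>, \<iota>)\<close>, that is, multiplying both permutations by the
  transposition of \<open>a\<close> and \<open>x\<close>, does not change \<open>\<tau> \<iota>\<close>, and splits a face of \<open>\<tau>\<close> or merges two faces.
  A connected gluing of two faces has genus 0 iff exactly one deletion is a merge, whatever the order
  of the deletions. Deleting the edge at a fixed label of the first face yields Tutte-style
  recurrences for the numbers of gluings with given face sizes. Summed over the face sizes,
  with \<open>t\<close> marking labels, they become linear equations for the generating functions \<open>E\<close> (all gluings) and \<open>B\<close>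
  (bicolored gluings) with coefficient \<open>1 - 2 Y = sqrt (1 - 4 t\<^sup>2)\<close>, where \<open>Y = t\<^sup>2 + Y\<^sup>2\<close> enumerates planar one-face gluings.
  The solutions are \<open>E = t\<^sup>2 / (1 - 4 t\<^sup>2)\<^sup>2\<close> and \<open>B = t\<^sup>2 E\<close>.\<close>

section \<open>Cycles of a permutation times a transposition\<close>

text \<open>The recursion does not stay among gluings of two faces: a split creates a third cycle
  with a matching of its own, and each deletion leaves two fixed points of the matching behind. The
  counts are therefore proved for an arbitrary permutation \<open>p\<close> of \<open>A\<close> with
  a set \<open>D\<close> of labels still matched, as products over the cycles of \<open>p\<close>.
  Transitivity does not survive a split either; it is replaced by the existence of an edge between
  two chosen cycles \<open>F\<close> and \<open>G\<close>. Colors are handled by a flag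
  \<open>c\<close>. In the recurrence for given face sizes they matter in one place: a label of the
  first face can be joined to only half of the labels of the second. Inside a face the color rule
  changes nothing, because an edge violating it leaves odd numbers of labels on both sides. Hence E
  and B satisfy equations with the same coefficient and differ only in the source term. Summing the
  number of partners over the face sizes gives a polynomial factor in the total size, so the source
  terms are combinations of derivatives of Y.\<close>

definition cycles_on :: "'a set \<Rightarrow> ('a \<Rightarrow> 'a) \<Rightarrow> 'a set set" where
  "cycles_on A p = orbit p ` A"

lemma orbit_eq_orbit:
  assumes "permutation p" "y \<in> orbit p x"
  shows "orbit p y = orbit p x"
  using cyclic_on_orbit'[OF assms(1)] assms(2) by (rule orbit_cyclic_eq3)

lemma mem_orbit_iff:
  assumes "permutation p"
  shows "y \<in> orbit p x \<longleftrightarrow> orbit p y = orbit p x"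
proof
  assume "orbit p y = orbit p x"
  then show "y \<in> orbit p x" using permutation_self_in_orbit[OF assms, of y] by simp
qed (rule orbit_eq_orbit[OF assms])

lemma orbits_disjoint:
  assumes "permutation p" "orbit p x \<noteq> orbit p y"
  shows "orbit p x \<inter> orbit p y = {}"
  using assms(2) by (auto simp: mem_orbit_iff[OF assms(1)])

lemma permutation_compose_transpose:
  assumes "permutation p"
  shows "permutation (p \<circ> transpose a x)"
  by (intro permutation_compose permutation_swap_id assms)

lemma compose_transpose_twice: "p \<circ> transpose a x \<circ> transpose a x = p"
  by (simp add: fun_eq_iff)

text \<open>Multiplying by the transposition sends \<open>a\<close> where \<open>x\<close> went
  before and conversely, so from there on the new permutation shadows the old one until it meets
  \<open>a\<close> or \<open>x\<close>. Both merging and splitting rest on this.\<close>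

lemma funpow_eq_segment:
  assumes "q y = p z" "\<And>j. \<lbrakk>0 < j; j < k\<rbrakk> \<Longrightarrow> q ((p ^^ j) z) = p ((p ^^ j) z)" "0 < j" "j \<le> k"
  shows "(q ^^ j) y = (p ^^ j) z"
  using assms(3,4)
proof (induction j)
  case (Suc j)
  show ?case
  proof (cases "j = 0")
    case False
    then have "(q ^^ j) y = (p ^^ j) z" using Suc by simp
    then show ?thesis using assms(2)[of j] False Suc.prems by simp
  qed (use assms(1) in simp)
qed simp

lemma orbit_compose_transpose_subset:
  assumes "permutation p" "x \<notin> orbit p a"
  shows "orbit p x \<subseteq> orbit (p \<circ> transpose a x) a"
proof
  fix y assume y: "y \<in> orbit p x"
  let ?k = "funpow_dist1 p x y" and ?L = "funpow_dist1 p x x"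
  have xx: "x \<in> orbit p x" using assms(1) by (rule permutation_self_in_orbit)
  have k: "(p ^^ ?k) x = y" using funpow_dist1_prop[OF y] .
  have L: "(p ^^ ?L) x = x" using funpow_dist1_prop[OF xx] .
  have le: "?k \<le> ?L" using funpow_dist1_le_self[OF L _ y] by simp
  have na: "(p ^^ j) x \<noteq> a" for j
  proof
    assume "(p ^^ j) x = a"
    then have "a \<in> orbit p x" using funpow_in_orbit[OF xx] by metis
    then show False using assms(2) by (simp add: mem_orbit_iff[OF assms(1)])
  qed
  have "((p \<circ> transpose a x) ^^ ?k) a = (p ^^ ?k) x"
  proof (rule funpow_eq_segment[where k = ?L])
    fix j assume "0 < j" "j < ?L"
    then have "(p ^^ j) x \<noteq> x" by (rule funpow_dist1_least)
    then show "(p \<circ> transpose a x) ((p ^^ j) x) = p ((p ^^ j) x)"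
      using na[of j] by (simp add: transpose_def)
  qed (use le in simp_all)
  then show "y \<in> orbit (p \<circ> transpose a x) a"
    unfolding orbit_altdef k by (metis (mono_tags, lifting) mem_Collect_eq zero_less_Suc)
qed

text \<open>\<open>orbit_compose_transpose_subset\<close> puts the cycle of \<open>x\<close> inside
  the new cycle of \<open>a\<close>; exchanging \<open>a\<close> and \<open>x\<close> leaves the
  transposition unchanged and handles the cycle of \<open>a\<close>. Conversely, the union is closed
  under the new permutation.\<close>

lemma orbit_merge:
  assumes p: "permutation p" and x: "x \<notin> orbit p a"
  shows "orbit (p \<circ> transpose a x) a = orbit p a \<union> orbit p x"
proof
  let ?q = "p \<circ> transpose a x"
  have q: "permutation ?q" using p by (rule permutation_compose_transpose)
  have a: "a \<notin> orbit p x"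
    using x by (simp add: mem_orbit_iff[OF p])
  have 1: "orbit p x \<subseteq> orbit ?q a" using p x by (rule orbit_compose_transpose_subset)
  have "orbit p a \<subseteq> orbit (p \<circ> transpose x a) x" using p a by (rule orbit_compose_transpose_subset)
  also have "\<dots> = orbit ?q x" by (simp add: transpose_commute)
  also have "\<dots> = orbit ?q a"
    using 1 permutation_self_in_orbit[OF p, of x] by (auto simp: mem_orbit_iff[OF q])
  finally show "orbit p a \<union> orbit p x \<subseteq> orbit ?q a" using 1 by blast
  show "orbit ?q a \<subseteq> orbit p a \<union> orbit p x"
  proof
    fix y assume "y \<in> orbit ?q a"
    then show "y \<in> orbit p a \<union> orbit p x"
      by induction (auto simp: transpose_def intro: orbit.intros)
  qed
qed

lemma orbit_compose_transpose_other:
  assumes "permutation p" "a \<notin> orbit p y" "x \<notin> orbit p y"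
  shows "orbit (p \<circ> transpose a x) y = orbit p y"
  using assms by (intro orbit_cong) (auto simp: transpose_def permutation_self_in_orbit)

lemma cycles_merge:
  assumes p: "permutation p" and A: "a \<in> A" "x \<in> A" and x: "x \<notin> orbit p a"
  shows "cycles_on A (p \<circ> transpose a x) =
    insert (orbit p a \<union> orbit p x) (cycles_on A p - {orbit p a, orbit p x})"
proof -
  let ?q = "p \<circ> transpose a x" and ?U = "orbit p a \<union> orbit p x"
  have q: "permutation ?q" using p by (rule permutation_compose_transpose)
  have U: "orbit ?q a = ?U" using p x by (rule orbit_merge)
  have in_U: "orbit ?q y = ?U" if "y \<in> ?U" for y
    using orbit_eq_orbit[OF q, of y a] U that by simp
  have out_U: "orbit ?q y = orbit p y \<and> orbit p y \<notin> {orbit p a, orbit p x}" if "y \<notin> ?U" for y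
  proof -
    have "orbit p y \<noteq> orbit p a" "orbit p y \<noteq> orbit p x" using that by (auto simp: mem_orbit_iff[OF p])
    moreover from this have "a \<notin> orbit p y" "x \<notin> orbit p y" by (auto simp: mem_orbit_iff[OF p])
    ultimately show ?thesis using orbit_compose_transpose_other[OF p] by simp
  qed
  have "orbit ?q y \<in> insert ?U (cycles_on A p - {orbit p a, orbit p x})" if "y \<in> A" for y
    using in_U[of y] out_U[of y] that by (cases "y \<in> ?U") (auto simp: cycles_on_def)
  moreover have "?U \<in> cycles_on A ?q" using U A by (auto simp: cycles_on_def)
  moreover have "C \<in> cycles_on A ?q" if C: "C \<in> cycles_on A p - {orbit p a, orbit p x}" for C
  proof -
    from C obtain y where y: "y \<in> A" "C = orbit p y" by (auto simp: cycles_on_def)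
    have "y \<notin> ?U" using C y(2) by (auto simp: mem_orbit_iff[OF p])
    then show ?thesis using out_U y by (auto simp: cycles_on_def)
  qed
  ultimately show ?thesis by (intro equalityI subsetI) (auto simp: cycles_on_def)
qed

text \<open>After the transposition \<open>x\<close> continues where \<open>a\<close> used to, runs
  along the old cycle up to \<open>x\<close> and closes there. The explicit segment is recorded
  because a later count uses that these segments are nested as \<open>x\<close> varies.\<close>

lemma orbit_split_segment:
  assumes p: "permutation p" and x: "x \<in> orbit p a" "x \<noteq> a"
  shows "orbit (p \<circ> transpose a x) x = (\<lambda>j. (p ^^ j) a) ` {1..funpow_dist1 p a x}"
proof -
  let ?q = "p \<circ> transpose a x" and ?k = "funpow_dist1 p a x"
  have k: "(p ^^ ?k) a = x" using funpow_dist1_prop[OF x(1)] .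
  have seg: "(?q ^^ j) x = (p ^^ j) a" if "0 < j" "j \<le> ?k" for j
  proof (rule funpow_eq_segment[where k = ?k])
    fix j assume j: "0 < j" "j < ?k"
    have "(p ^^ j) a \<noteq> x" using j by (rule funpow_dist1_least)
    moreover have "(p ^^ j) a \<noteq> a"
      using funpow_neq_less_funpow_dist1[OF x(1), of j 0] j by simp
    ultimately show "?q ((p ^^ j) a) = p ((p ^^ j) a)" by (simp add: transpose_def)
  qed (use that in simp_all)
  have "orbit ?q x = {(?q ^^ m) x |m. m < ?k}"
    using seg[of ?k] k by (intro orbit_altdef_bounded) simp_all
  also have "\<dots> = (\<lambda>j. (?q ^^ j) x) ` {1..?k}"
  proof -
    have 0: "(?q ^^ 0) x = (?q ^^ ?k) x" using seg[of ?k] k by simp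
    show ?thesis
    proof safe
      fix m assume "m < ?k"
      then show "(?q ^^ m) x \<in> (\<lambda>j. (?q ^^ j) x) ` {1..?k}"
        by (cases "m = 0") (use 0 in \<open>auto intro: image_eqI[where x = ?k] image_eqI[where x = m]\<close>)
    next
      fix j assume "j \<in> {1..?k}"
      then show "\<exists>m. (?q ^^ j) x = (?q ^^ m) x \<and> m < ?k"
        by (cases "j = ?k") (use 0 in \<open>auto intro: exI[of _ 0] exI[of _ j]\<close>)
    qed
  qed
  also have "\<dots> = (\<lambda>j. (p ^^ j) a) ` {1..?k}"
    using seg by (intro image_cong) auto
  finally show ?thesis .
qed

text \<open>A split is a merge read backwards, since the same transposition applied again restores
  \<open>p\<close>. The explicit segment serves to show that \<open>a\<close> and \<open>x\<close>
  are separated; the rest follows from \<open>orbit_merge\<close> for the new permutation and from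
  the disjointness of distinct cycles.\<close>

lemma orbit_split:
  assumes p: "permutation p" and x: "x \<in> orbit p a" "x \<noteq> a"
  shows "a \<notin> orbit (p \<circ> transpose a x) x"
    and "orbit (p \<circ> transpose a x) a \<union> orbit (p \<circ> transpose a x) x = orbit p a"
    and "orbit (p \<circ> transpose a x) a \<inter> orbit (p \<circ> transpose a x) x = {}"
proof -
  let ?q = "p \<circ> transpose a x"
  have q: "permutation ?q" using p by (rule permutation_compose_transpose)
  have "(p ^^ j) a \<noteq> a" if "j \<in> {1..funpow_dist1 p a x}" for j
  proof (cases "j = funpow_dist1 p a x")
    case True
    then show ?thesis using funpow_dist1_prop[OF x(1)] x(2) by metis
  next
    case False
    then show ?thesis using funpow_neq_less_funpow_dist1[OF x(1), of j 0] that by simp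
  qed
  then have "a \<noteq> (p ^^ j) a" if "j \<in> {1..funpow_dist1 p a x}" for j using that by metis
  then show a: "a \<notin> orbit ?q x" unfolding orbit_split_segment[OF p x] by (intro notI) (elim imageE, simp)
  then have ne: "x \<notin> orbit ?q a" by (simp add: mem_orbit_iff[OF q])
  show "orbit ?q a \<union> orbit ?q x = orbit p a"
    using orbit_merge[OF q ne] unfolding compose_transpose_twice by simp
  show "orbit ?q a \<inter> orbit ?q x = {}"
    using a by (intro orbits_disjoint[OF q]) (simp add: mem_orbit_iff[OF q])
qed

lemma cycles_on_disjoint:
  assumes "permutation p" "C \<in> cycles_on A p" "C' \<in> cycles_on A p" "C \<noteq> C'"
  shows "C \<inter> C' = {}"
  using assms(2-4) by (auto simp: cycles_on_def mem_orbit_iff[OF assms(1)])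

lemma orbit_of_cycle:
  assumes "permutation p" "C \<in> cycles_on A p" "y \<in> C"
  shows "orbit p y = C"
  using assms(2,3) by (auto simp: cycles_on_def mem_orbit_iff[OF assms(1)])

text \<open>Obtained by merging back. The freshness of both new cycles is stated so that
  cardinalities and products over the cycles can be computed through \<open>insert\<close>.\<close>

lemma cycles_split:
  assumes p: "permutation p" and A: "a \<in> A" "x \<in> A" and x: "x \<in> orbit p a" "x \<noteq> a"
  defines "q \<equiv> p \<circ> transpose a x"
  shows "cycles_on A q = insert (orbit q a) (insert (orbit q x) (cycles_on A p - {orbit p a}))"
    and "orbit q a \<noteq> orbit q x"
    and "orbit q a \<notin> cycles_on A p - {orbit p a}" "orbit q x \<notin> cycles_on A p - {orbit p a}"
proof -
  have q: "permutation q" unfolding q_def using p by (rule permutation_compose_transpose)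
  have qp: "q \<circ> transpose a x = p" unfolding q_def by (rule compose_transpose_twice)
  note sp = orbit_split[OF p x, folded q_def]
  show ne: "orbit q a \<noteq> orbit q x" using sp(1) by (simp add: mem_orbit_iff[OF q])
  then have xa: "x \<notin> orbit q a" by (simp add: mem_orbit_iff[OF q])
  have eq: "cycles_on A p = insert (orbit p a) (cycles_on A q - {orbit q a, orbit q x})"
    using cycles_merge[OF q A xa] unfolding qp sp(2) .
  have "orbit p a \<notin> cycles_on A q"
  proof
    assume "orbit p a \<in> cycles_on A q"
    then have "orbit q a = orbit p a"
      by (rule orbit_of_cycle[OF q _ permutation_self_in_orbit[OF p]])
    then show False using sp(2) xa permutation_self_in_orbit[OF q, of x] by blast
  qed
  then have *: "cycles_on A p - {orbit p a} = cycles_on A q - {orbit q a, orbit q x}"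
    using eq by blast
  have "orbit q a \<in> cycles_on A q" "orbit q x \<in> cycles_on A q"
    using A by (auto simp: cycles_on_def)
  then show "cycles_on A q = insert (orbit q a) (insert (orbit q x) (cycles_on A p - {orbit p a}))"
    unfolding * by blast
  show "orbit q a \<notin> cycles_on A p - {orbit p a}" "orbit q x \<notin> cycles_on A p - {orbit p a}"
    unfolding * by simp_all
qed

lemma finite_cycles_on: "finite A \<Longrightarrow> finite (cycles_on A p)"
  unfolding cycles_on_def by simp

lemma card_cycles_split:
  assumes "permutation p" "finite A" "a \<in> A" "x \<in> A" "x \<in> orbit p a" "x \<noteq> a"
  shows "card (cycles_on A (p \<circ> transpose a x)) = card (cycles_on A p) + 1"
proof -
  have "orbit p a \<in> cycles_on A p" using assms(3) by (simp add: cycles_on_def)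
  then have "card (cycles_on A p) = Suc (card (cycles_on A p - {orbit p a}))"
    by (rule card.remove[OF finite_cycles_on[OF assms(2)]])
  then show ?thesis
    using cycles_split[OF assms(1,3-6)] finite_cycles_on[OF assms(2), of p] by simp
qed

lemma card_cycles_merge:
  assumes "permutation p" "finite A" "a \<in> A" "x \<in> A" "x \<notin> orbit p a"
  shows "card (cycles_on A (p \<circ> transpose a x)) + 1 = card (cycles_on A p)"
proof -
  let ?q = "p \<circ> transpose a x"
  have q: "permutation ?q" using assms(1) by (rule permutation_compose_transpose)
  have "x \<in> orbit ?q a"
    using orbit_merge[OF assms(1,5)] permutation_self_in_orbit[OF assms(1), of x] by simp
  moreover have "x \<noteq> a" using assms(5) permutation_self_in_orbit[OF assms(1), of a] by auto
  ultimately show ?thesis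
    using card_cycles_split[OF q assms(2-4)] unfolding compose_transpose_twice by simp
qed

text \<open>As \<open>x\<close> runs over the marked points of a cycle other than \<open>a\<close>, the segment from \<open>a\<close>
  to \<open>x\<close> grows, so the number of marked points strictly inside it takes each value once.\<close>

lemma bij_betw_split_card:
  assumes p: "permutation p" and a: "a \<in> D"
  shows "bij_betw (\<lambda>x. card ((D - {a, x}) \<inter> orbit (p \<circ> transpose a x) x))
    (D \<inter> orbit p a - {a}) {..<card (D \<inter> orbit p a) - 1}" (is "bij_betw ?i ?X ?Y")
proof -
  define S where "S x = orbit (p \<circ> transpose a x) x" for x
  have fin: "finite (orbit p a)"
    by (rule finite_orbit[OF permutation_self_in_orbit[OF p]])
  have xS: "x \<in> S x" for x
    unfolding S_def by (intro permutation_self_in_orbit permutation_compose_transpose p)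
  have aS: "a \<notin> S x" "S x \<subseteq> orbit p a" if "x \<in> ?X" for x
  proof -
    have x: "x \<in> orbit p a" "x \<noteq> a" using that by simp_all
    show "a \<notin> S x" unfolding S_def by (rule orbit_split(1)[OF p x])
    show "S x \<subseteq> orbit p a" unfolding S_def orbit_split(2)[OF p x, symmetric] by (rule Un_upper2)
  qed
  have i: "?i x = card (D \<inter> S x - {x})" if "x \<in> ?X" for x
  proof -
    have "(D - {a, x}) \<inter> S x = D \<inter> S x - {x}" using aS(1)[OF that] by auto
    then show ?thesis unfolding S_def by simp
  qed
  have less: "?i x < ?i y"
    if xy: "x \<in> ?X" "y \<in> ?X" "funpow_dist1 p a x < funpow_dist1 p a y" for x y
  proof -
    have Sx: "S x = (\<lambda>j. (p ^^ j) a) ` {1..funpow_dist1 p a x}"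
      and Sy: "S y = (\<lambda>j. (p ^^ j) a) ` {1..funpow_dist1 p a y}"
      unfolding S_def using xy orbit_split_segment[OF p, of x a] orbit_split_segment[OF p, of y a]
      by (simp_all del: funpow.simps)
    have "{1..funpow_dist1 p a x} \<subseteq> {1..funpow_dist1 p a y}" using xy(3) by simp
    then have "S x \<subseteq> S y" unfolding Sx Sy by (rule image_mono)
    moreover have "y \<notin> S x"
    proof
      assume "y \<in> S x"
      then obtain j where j: "y = (p ^^ j) a" "j \<in> {1..funpow_dist1 p a x}"
        unfolding Sx by (rule imageE)
      then have "0 < j" "j < funpow_dist1 p a y" using xy(3) by simp_all
      then have "(p ^^ j) a \<noteq> y" by (rule funpow_dist1_least)
      then show False using j(1) by simp
    qed
    ultimately have "D \<inter> S x - {x} \<subset> D \<inter> S y - {y}" using xS[of x] xy(1) by auto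
    moreover have "finite (D \<inter> S y - {y})" using finite_subset[OF aS(2)[OF xy(2)] fin] by simp
    ultimately show ?thesis unfolding i[OF xy(1)] i[OF xy(2)] by (intro psubset_card_mono)
  qed
  have inj: "inj_on ?i ?X"
  proof (rule inj_onI)
    fix x y assume xy: "x \<in> ?X" "y \<in> ?X" "?i x = ?i y"
    then have "funpow_dist1 p a x = funpow_dist1 p a y"
      using less[of x y] less[of y x] by linarith
    moreover have "(p ^^ funpow_dist1 p a x) a = x" "(p ^^ funpow_dist1 p a y) a = y"
      using xy(1,2) by (auto intro!: funpow_dist1_prop simp del: funpow.simps)
    ultimately show "x = y" by metis
  qed
  have cX: "card ?X = card (D \<inter> orbit p a) - 1"
    using a permutation_self_in_orbit[OF p, of a] by (intro card_Diff_singleton) simp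
  have "?i x < card ?X" if "x \<in> ?X" for x
  proof -
    have "D \<inter> S x - {x} \<subset> ?X" using aS[OF that] that by auto
    then show ?thesis unfolding i[OF that] using fin by (intro psubset_card_mono) simp_all
  qed
  then have "?i ` ?X \<subseteq> ?Y" unfolding cX by blast
  moreover have "card (?i ` ?X) = card ?Y" using card_image[OF inj] cX by simp
  ultimately have "?i ` ?X = ?Y" by (intro card_subset_eq) simp_all
  with inj show ?thesis by (simp add: bij_betw_def)
qed

section \<open>Matchings\<close>

definition pairings :: "('a \<Rightarrow> 'a \<Rightarrow> bool) \<Rightarrow> 'a set \<Rightarrow> ('a \<Rightarrow> 'a) set" where
  "pairings R D = {\<iota>. \<iota> permutes D \<and> (\<forall>x\<in>D. \<iota> (\<iota> x) = x \<and> \<iota> x \<noteq> x \<and> R x (\<iota> x))}"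

lemma finite_pairings: "finite D \<Longrightarrow> finite (pairings R D)"
  by (rule finite_subset[OF _ finite_permutations[of D]]) (auto simp: pairings_def)

lemma pairings_empty: "pairings R {} = {id}"
  by (auto simp: pairings_def permutes_empty)

lemma pairings_outside: "\<iota> \<in> pairings R D \<Longrightarrow> y \<notin> D \<Longrightarrow> \<iota> y = y"
  by (auto simp: pairings_def permutes_not_in)

lemma pairings_mem: "\<iota> \<in> pairings R D \<Longrightarrow> y \<in> D \<Longrightarrow> \<iota> y \<in> D"
  by (auto simp: pairings_def permutes_in_image)

lemma pairings_cases:
  assumes \<iota>: "\<iota> \<in> pairings R D" and a: "a \<in> D"
  obtains \<kappa> where "\<iota> a \<in> D" "\<iota> a \<noteq> a" "R a (\<iota> a)" "\<kappa> \<in> pairings R (D - {a, \<iota> a})"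
    "\<iota> = transpose a (\<iota> a) \<circ> \<kappa>"
proof
  let ?x = "\<iota> a" and ?D = "D - {a, \<iota> a}"
  let ?\<kappa> = "transpose a ?x \<circ> \<iota>"
  have perm: "\<iota> permutes D" and inv: "\<And>x. x \<in> D \<Longrightarrow> \<iota> (\<iota> x) = x"
    using \<iota> by (auto simp: pairings_def)
  show x: "?x \<in> D" "?x \<noteq> a" "R a ?x" using \<iota> a pairings_mem[OF \<iota> a] by (auto simp: pairings_def)
  show "\<iota> = transpose a ?x \<circ> ?\<kappa>" by (simp add: fun_eq_iff)
  have \<kappa>: "?\<kappa> y = \<iota> y \<and> \<iota> y \<in> ?D" if "y \<in> ?D" for y
  proof -
    have "\<iota> y \<noteq> a" "\<iota> y \<noteq> ?x" using inv[of y] inv[OF a] that by auto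
    then show ?thesis using pairings_mem[OF \<iota>, of y] that by (simp add: transpose_def)
  qed
  have "?\<kappa> permutes D" using perm x a by (intro permutes_compose permutes_swap_id)
  moreover have "?\<kappa> y = y" if "y \<in> D - ?D" for y using that inv[OF a] by auto
  ultimately have "?\<kappa> permutes ?D" by (rule permutes_superset)
  then show "?\<kappa> \<in> pairings R ?D" using \<kappa> \<iota> by (auto simp: pairings_def)
qed

lemma pairings_insert:
  assumes "a \<in> D" "x \<in> D" "x \<noteq> a" "R a x" "R x a" and \<kappa>: "\<kappa> \<in> pairings R (D - {a, x})"
  shows "transpose a x \<circ> \<kappa> \<in> pairings R D" "(transpose a x \<circ> \<kappa>) a = x"
proof -
  have fix_ax: "\<kappa> a = a" "\<kappa> x = x" using pairings_outside[OF \<kappa>] by auto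
  then show "(transpose a x \<circ> \<kappa>) a = x" by simp
  have \<kappa>_in: "\<kappa> y \<in> D - {a, x}" if "y \<in> D - {a, x}" for y using pairings_mem[OF \<kappa> that] .
  have "\<kappa> permutes D"
    using \<kappa> by (auto simp: pairings_def intro: permutes_subset)
  then have "(transpose a x \<circ> \<kappa>) permutes D"
    using assms by (intro permutes_compose permutes_swap_id)
  moreover have "(transpose a x \<circ> \<kappa>) ((transpose a x \<circ> \<kappa>) y) = y \<and>
      (transpose a x \<circ> \<kappa>) y \<noteq> y \<and> R y ((transpose a x \<circ> \<kappa>) y)" if y: "y \<in> D" for y
  proof -
    consider "y = a" | "y = x" | "y \<in> D - {a, x}" using y by blast
    then show ?thesis
    proof cases
      case 3
      then have "\<kappa> y \<notin> {a, x}" "\<kappa> (\<kappa> y) = y" "\<kappa> y \<noteq> y" "R y (\<kappa> y)" "y \<notin> {a, x}"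
        using \<kappa>_in[OF 3] \<kappa> by (auto simp: pairings_def)
      then show ?thesis by simp
    qed (use fix_ax assms(3-5) in auto)
  qed
  ultimately show "transpose a x \<circ> \<kappa> \<in> pairings R D"
    unfolding pairings_def by blast
qed

text \<open>Matchings are sorted by the partner \<open>x\<close> of \<open>a\<close>. Composing with
  \<open>transpose a x\<close> is its own inverse, hence injective. \<open>P\<close> stays arbitrary
  because the recursion serves planar and annular matchings alike.\<close>

lemma card_pairings_rec:
  assumes D: "finite D" and a: "a \<in> D" and R: "symp R"
  shows "card {\<iota> \<in> pairings R D. P \<iota>} =
    (\<Sum>x | x \<in> D - {a} \<and> R a x. card {\<kappa> \<in> pairings R (D - {a, x}). P (transpose a x \<circ> \<kappa>)})"
proof -
  let ?X = "{x. x \<in> D - {a} \<and> R a x}"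
  let ?K = "\<lambda>x. {\<kappa> \<in> pairings R (D - {a, x}). P (transpose a x \<circ> \<kappa>)}"
  have ins: "transpose a x \<circ> \<kappa> \<in> pairings R D" "(transpose a x \<circ> \<kappa>) a = x"
    if "x \<in> ?X" "\<kappa> \<in> ?K x" for x \<kappa>
    using that pairings_insert[of a D x R \<kappa>] a sympD[OF R, of a x] by auto
  have eq: "{\<iota> \<in> pairings R D. P \<iota>} = (\<Union>x\<in>?X. (\<lambda>\<kappa>. transpose a x \<circ> \<kappa>) ` ?K x)"
  proof (intro equalityI subsetI)
    fix \<iota> assume "\<iota> \<in> {\<iota> \<in> pairings R D. P \<iota>}"
    then have \<iota>: "\<iota> \<in> pairings R D" "P \<iota>" by auto
    obtain \<kappa> where "\<iota> a \<in> D" "\<iota> a \<noteq> a" "R a (\<iota> a)" "\<kappa> \<in> pairings R (D - {a, \<iota> a})"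
      "\<iota> = transpose a (\<iota> a) \<circ> \<kappa>"
      using pairings_cases[OF \<iota>(1) a] .
    then have "\<iota> a \<in> ?X" "\<kappa> \<in> ?K (\<iota> a)" using \<iota>(2) by auto
    then show "\<iota> \<in> (\<Union>x\<in>?X. (\<lambda>\<kappa>. transpose a x \<circ> \<kappa>) ` ?K x)"
      using \<open>\<iota> = transpose a (\<iota> a) \<circ> \<kappa>\<close> by blast
  qed (use ins in auto)
  have "card {\<iota> \<in> pairings R D. P \<iota>} = (\<Sum>x\<in>?X. card ((\<lambda>\<kappa>. transpose a x \<circ> \<kappa>) ` ?K x))"
    unfolding eq
  proof (rule card_UN_disjoint)
    show "\<forall>x\<in>?X. \<forall>y\<in>?X. x \<noteq> y \<longrightarrow>
        ((\<lambda>\<kappa>. transpose a x \<circ> \<kappa>) ` ?K x) \<inter> ((\<lambda>\<kappa>. transpose a y \<circ> \<kappa>) ` ?K y) = {}"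
    proof (intro ballI impI)
      fix x y assume xy: "x \<in> ?X" "y \<in> ?X" "x \<noteq> y"
      show "((\<lambda>\<kappa>. transpose a x \<circ> \<kappa>) ` ?K x) \<inter> ((\<lambda>\<kappa>. transpose a y \<circ> \<kappa>) ` ?K y) = {}"
      proof (rule Int_emptyI)
        fix \<iota>
        assume "\<iota> \<in> (\<lambda>\<kappa>. transpose a x \<circ> \<kappa>) ` ?K x"
        then have "\<iota> a = x" by (rule imageE) (simp only: ins(2)[OF xy(1)])
        moreover assume "\<iota> \<in> (\<lambda>\<kappa>. transpose a y \<circ> \<kappa>) ` ?K y"
        then have "\<iota> a = y" by (rule imageE) (simp only: ins(2)[OF xy(2)])
        ultimately show False using xy(3) by simp
      qed
    qed
  next
    show "finite ?X" using D by simp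
    show "\<forall>x\<in>?X. finite ((\<lambda>\<kappa>. transpose a x \<circ> \<kappa>) ` ?K x)"
      using finite_pairings[of _ R] D by simp
  qed
  also have "\<dots> = (\<Sum>x\<in>?X. card (?K x))"
  proof (intro sum.cong refl card_image)
    fix x
    show "inj_on (\<lambda>\<kappa>. transpose a x \<circ> \<kappa>) (?K x)"
      by (rule inj_on_inverseI[where g = "\<lambda>\<kappa>. transpose a x \<circ> \<kappa>"]) (simp add: fun_eq_iff)
  qed
  finally show ?thesis .
qed

lemma card_remove_pair:
  assumes "finite D" "a \<in> D" "x \<in> D" "x \<noteq> a"
  shows "card D = Suc (Suc (card (D - {a, x})))"
proof -
  have "card D = card (insert a (insert x (D - {a, x})))"
    using assms by (intro arg_cong[where f = card]) auto
  then show ?thesis using assms by simp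
qed

text \<open>In \<^term>\<open>pairings R D\<close> the points outside \<open>D\<close> are fixed. Deleting an edge \<open>{a, x}\<close> replaces
  \<open>p\<close> by \<open>p \<circ> transpose a x\<close> and leaves \<open>p \<circ> \<iota>\<close> unchanged, so that no relabeling is needed. An edge
  within a cycle of \<open>p\<close> splits it and an edge between two cycles merges them; hence
  \<open>planar\<close> means that only splits occur, and \<open>deficient\<close> that exactly one merge occurs.\<close>

definition planar :: "'a set \<Rightarrow> 'a set \<Rightarrow> ('a \<Rightarrow> 'a) \<Rightarrow> ('a \<Rightarrow> 'a) \<Rightarrow> bool" where
  "planar A D p \<iota> \<longleftrightarrow> card (cycles_on A (p \<circ> \<iota>)) = card (cycles_on A p) + card D div 2"

definition deficient :: "'a set \<Rightarrow> 'a set \<Rightarrow> ('a \<Rightarrow> 'a) \<Rightarrow> ('a \<Rightarrow> 'a) \<Rightarrow> bool" where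
  "deficient A D p \<iota> \<longleftrightarrow> card (cycles_on A (p \<circ> \<iota>)) + 2 = card (cycles_on A p) + card D div 2"

text \<open>Each of the \<open>card D div 2\<close> deletions raises the number of cycles by at most
  one. Attaining this bound is the definition of \<open>planar\<close>.\<close>

lemma card_cycles_pairing_le:
  assumes "permutation p" "finite A" "D \<subseteq> A" "\<iota> \<in> pairings R D"
  shows "card (cycles_on A (p \<circ> \<iota>)) \<le> card (cycles_on A p) + card D div 2"
  using assms
proof (induction "card D" arbitrary: D p \<iota> rule: less_induct)
  case less
  show ?case
  proof (cases "D = {}")
    case True
    then show ?thesis using less.prems(4) by (simp add: pairings_empty)
  next
    case False
    then obtain a where a: "a \<in> D" by blast
    define x where "x = \<iota> a"
    obtain \<kappa> where x: "x \<in> D" "x \<noteq> a" and \<kappa>: "\<kappa> \<in> pairings R (D - {a, x})"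
      and \<iota>: "\<iota> = transpose a x \<circ> \<kappa>"
      using pairings_cases[OF less.prems(4) a] unfolding x_def by metis
    have D: "finite D" using less.prems(2,3) by (rule rev_finite_subset)
    have c: "card D = Suc (Suc (card (D - {a, x})))" using D a x by (rule card_remove_pair)
    have A: "a \<in> A" "x \<in> A" using a x less.prems(3) by auto
    let ?q = "p \<circ> transpose a x"
    have "card (cycles_on A (?q \<circ> \<kappa>)) \<le> card (cycles_on A ?q) + card (D - {a, x}) div 2"
      using c less.prems \<kappa> by (intro less.hyps permutation_compose_transpose) auto
    moreover have "card (cycles_on A ?q) \<le> card (cycles_on A p) + 1"
      using card_cycles_split[OF less.prems(1,2) A _ x(2)] card_cycles_merge[OF less.prems(1,2) A]
      by (cases "x \<in> orbit p a") auto
    ultimately show ?thesis unfolding \<iota> c by (simp add: comp_assoc)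
  qed
qed

context
  fixes p :: "'a \<Rightarrow> 'a" and A D :: "'a set" and R a x \<kappa>
  assumes p: "permutation p" and A: "finite A" "D \<subseteq> A"
    and ax: "a \<in> D" "x \<in> D" "x \<noteq> a" and \<kappa>: "\<kappa> \<in> pairings R (D - {a, x})"
begin

text \<open>A merge loses one cycle where the bound counts on a gain of one; by
  \<open>card_cycles_pairing_le\<close> the remaining edges cannot make up for the deficit of
  two.\<close>

lemma planar_transpose_iff:
  "planar A D p (transpose a x \<circ> \<kappa>) \<longleftrightarrow>
    x \<in> orbit p a \<and> planar A (D - {a, x}) (p \<circ> transpose a x) \<kappa>"
proof -
  have card_D: "card D = Suc (Suc (card (D - {a, x})))"
    using rev_finite_subset[OF A] ax by (rule card_remove_pair)
  have axA: "a \<in> A" "x \<in> A" using ax A by auto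
  show ?thesis
  proof (cases "x \<in> orbit p a")
    case True
    then show ?thesis
      using card_cycles_split[OF p A(1) axA True ax(3)] by (simp add: planar_def card_D comp_assoc)
  next
    case False
    have "card (cycles_on A (p \<circ> transpose a x \<circ> \<kappa>)) \<le>
        card (cycles_on A (p \<circ> transpose a x)) + card (D - {a, x}) div 2"
      using A \<kappa> by (intro card_cycles_pairing_le permutation_compose_transpose p) auto
    then show ?thesis
      using card_cycles_merge[OF p A(1) axA False] False by (simp add: planar_def card_D comp_assoc)
  qed
qed

text \<open>The offset 2 in \<open>deficient\<close> is the loss of a merge compared with a split,
  so after a merge the rest has to attain the bound.\<close>

lemma deficient_transpose_iff:
  "deficient A D p (transpose a x \<circ> \<kappa>) \<longleftrightarrow>
    (if x \<in> orbit p a then deficient A (D - {a, x}) (p \<circ> transpose a x) \<kappa>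
     else planar A (D - {a, x}) (p \<circ> transpose a x) \<kappa>)"
proof -
  have card_D: "card D = Suc (Suc (card (D - {a, x})))"
    using rev_finite_subset[OF A] ax by (rule card_remove_pair)
  have axA: "a \<in> A" "x \<in> A" using ax A by auto
  show ?thesis
  proof (cases "x \<in> orbit p a")
    case True
    then show ?thesis
      using card_cycles_split[OF p A(1) axA True ax(3)] by (simp add: deficient_def card_D comp_assoc)
  next
    case False
    then show ?thesis
      using card_cycles_merge[OF p A(1) axA False]
      by (auto simp add: deficient_def planar_def card_D comp_assoc)
  qed
qed

end

text \<open>The order of deletions is free. Starting with the edge at \<open>y\<close>, this
  deletion must be a split.\<close>

lemma planar_in_orbit:
  assumes "permutation p" "finite A" "D \<subseteq> A" "\<iota> \<in> pairings R D" "planar A D p \<iota>"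
  shows "\<iota> y \<in> orbit p y"
proof (cases "y \<in> D")
  case True
  obtain \<kappa> where "\<iota> y \<in> D" "\<iota> y \<noteq> y" "\<kappa> \<in> pairings R (D - {y, \<iota> y})"
    and "\<iota> = transpose y (\<iota> y) \<circ> \<kappa>"
    using pairings_cases[OF assms(4) True] by metis
  then show ?thesis using planar_transpose_iff[OF assms(1-3) True, of "\<iota> y" \<kappa> R] assms(5) by simp
next
  case False
  then show ?thesis
    using pairings_outside[OF assms(4) False] permutation_self_in_orbit[OF assms(1), of y] by simp
qed

text \<open>Removing one edge that joins two cycles makes the rest planar, so every other joining edge
  must connect the same two cycles.\<close>

lemma deficient_joins_two_cycles:
  assumes p: "permutation p" and A: "finite A" "D \<subseteq> A" and \<iota>: "\<iota> \<in> pairings R D"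
    and def: "deficient A D p \<iota>" and y: "\<iota> y \<notin> orbit p y" and w: "\<iota> w \<notin> orbit p w"
  shows "orbit p w = orbit p y \<or> orbit p w = orbit p (\<iota> y)"
proof (rule ccontr)
  define x where "x = \<iota> y"
  assume "\<not> ?thesis"
  then have yx: "y \<notin> orbit p w" "x \<notin> orbit p w" by (auto simp: x_def mem_orbit_iff[OF p])
  have yD: "y \<in> D" using y pairings_outside[OF \<iota>, of y] permutation_self_in_orbit[OF p, of y]
    by (cases "y \<in> D") simp_all
  obtain \<kappa> where x: "x \<in> D" "x \<noteq> y" and \<kappa>: "\<kappa> \<in> pairings R (D - {y, x})"
    and \<iota>_eq: "\<iota> = transpose y x \<circ> \<kappa>"
    using pairings_cases[OF \<iota> yD] unfolding x_def by metis
  have "planar A (D - {y, x}) (p \<circ> transpose y x) \<kappa>"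
    using deficient_transpose_iff[OF p A yD x \<kappa>] def y by (simp add: x_def flip: \<iota>_eq[unfolded x_def])
  then have "\<kappa> w \<in> orbit (p \<circ> transpose y x) w"
    using A by (intro planar_in_orbit[OF permutation_compose_transpose[OF p] _ _ \<kappa>]) auto
  \<comment> \<open>The deleted edge avoids the cycle of \<open>w\<close>, which is therefore also a
    cycle of the new permutation.\<close>
  then have \<kappa>w: "\<kappa> w \<in> orbit p w" using orbit_compose_transpose_other[OF p yx] by simp
  moreover have "\<kappa> w \<noteq> y" "\<kappa> w \<noteq> x" using \<kappa>w yx by auto
  ultimately show False using w unfolding \<iota>_eq by (simp add: transpose_def)
qed

section \<open>Counting planar and annular matchings\<close>

text \<open>\<^term>\<open>cat m\<close> counts the noncrossing perfect matchings of \<open>m\<close> points on a circle: it is the Catalan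
  number of index \<open>m div 2\<close> for even \<open>m\<close>, and \<open>0\<close> for odd \<open>m\<close>.\<close>

fun cat :: "nat \<Rightarrow> nat" where
  "cat 0 = 1"
| "cat (Suc m) = (\<Sum>i<m. cat i * cat (m - 1 - i))"

text \<open>The number of possible partners on a cycle with \<open>n\<close> marked points: under
  the color rule, only the half of the opposite color.\<close>

definition half :: "bool \<Rightarrow> nat \<Rightarrow> nat" where
  "half c n = (if c then n div 2 else n)"

text \<open>\<^term>\<open>ann c m n\<close> counts the planar connected matchings of two circles with \<open>m\<close> and \<open>n\<close> points,
  respecting the colors if \<open>c\<close> holds (meaningful then only for even \<open>m\<close> and \<open>n\<close>). The first
  summand matches a fixed point of the first circle with one of the second circle, which turns the
  two circles into one; the sum matches it within the first circle, which is split in two.\<close>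

fun ann :: "bool \<Rightarrow> nat \<Rightarrow> nat \<Rightarrow> nat" where
  "ann c 0 n = 0"
| "ann c (Suc m) n = half c n * cat (m + n - 1) +
    (\<Sum>i<m. ann c i n * cat (m - 1 - i) + cat i * ann c (m - 1 - i) n)"

declare cat.simps(2) [simp del] ann.simps(2) [simp del]

lemma cat_odd: "odd n \<Longrightarrow> cat n = 0"
proof (induction n rule: less_induct)
  case (less n)
  then obtain m where m: "n = Suc m" "even m" by (cases n) auto
  have "cat i * cat (m - 1 - i) = 0" if "i < m" for i
  proof (cases "odd i")
    case True
    then show ?thesis using less.IH[of i] m that by simp
  next
    case False
    then have "odd (m - 1 - i)" using m that by simp
    then show ?thesis using less.IH[of "m - 1 - i"] m that by simp
  qed
  then show ?case by (simp add: m cat.simps)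
qed

section \<open>Color changes along a cycle\<close>

text \<open>\<open>p\<close> permutes \<open>G\<close>, so as many points are mapped to color
  \<open>True\<close> as have it. Cancelling those that have the color and keep it leaves equally
  many changes in either direction.\<close>

lemma card_toggles:
  fixes \<chi> :: "'a \<Rightarrow> bool"
  assumes p: "bij_betw p G G" and G: "finite G"
  shows "card {y \<in> G. \<chi> (p y) \<noteq> \<chi> y} = 2 * card {y \<in> G. \<chi> (p y) \<noteq> \<chi> y \<and> \<chi> y = b}"
proof -
  define T where "T b = {y \<in> G. \<chi> (p y) \<noteq> \<chi> y \<and> \<chi> y = b}" for b
  define S where "S = {y \<in> G. \<chi> (p y) \<and> \<chi> y}"
  have fin: "finite (T b)" "finite S" for b using G by (auto simp: T_def S_def)
  have "bij_betw p {y \<in> G. \<chi> (p y)} {y \<in> G. \<chi> y}"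
    using p by (rule bij_betw_Collect) simp
  then have "card {y \<in> G. \<chi> (p y)} = card {y \<in> G. \<chi> y}" by (rule bij_betw_same_card)
  moreover have "{y \<in> G. \<chi> (p y)} = T False \<union> S" "{y \<in> G. \<chi> y} = T True \<union> S"
    by (auto simp: T_def S_def)
  moreover have "T False \<inter> S = {}" "T True \<inter> S = {}" by (auto simp: T_def S_def)
  ultimately have eq: "card (T False) = card (T True)" using fin by (simp add: card_Un_disjoint)
  have "{y \<in> G. \<chi> (p y) \<noteq> \<chi> y} = T True \<union> T False" "T True \<inter> T False = {}"
    by (auto simp: T_def)
  then have "card {y \<in> G. \<chi> (p y) \<noteq> \<chi> y} = card (T True) + card (T False)"
    using fin by (simp add: card_Un_disjoint)
  also have "\<dots> = 2 * card (T b)" using eq by (cases b) simp_all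
  finally show ?thesis by (simp add: T_def)
qed

lemma bij_betw_orbit:
  assumes "permutation p"
  shows "bij_betw p (orbit p y) (orbit p y)"
proof -
  have inj: "inj_on p (orbit p y)" using permutation_bijective[OF assms] by (auto simp: bij_def intro: inj_on_subset)
  moreover have "p ` orbit p y \<subseteq> orbit p y" by (auto intro: orbit.step)
  ultimately have "p ` orbit p y = orbit p y"
    by (intro endo_inj_surj finite_orbit permutation_self_in_orbit assms)
  with inj show ?thesis by (simp add: bij_betw_def)
qed

definition edge_ok :: "bool \<Rightarrow> ('a \<Rightarrow> bool) \<Rightarrow> 'a \<Rightarrow> 'a \<Rightarrow> bool" where
  "edge_ok c \<chi> x y \<longleftrightarrow> (c \<longrightarrow> \<chi> x \<noteq> \<chi> y)"

text \<open>Points are colored so that \<open>p\<close> changes the color exactly at the points of \<open>D\<close>; deleting an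
  edge with ends of different colors preserves this for the unchanged coloring.\<close>

definition colored :: "bool \<Rightarrow> ('a \<Rightarrow> bool) \<Rightarrow> 'a set \<Rightarrow> 'a set \<Rightarrow> ('a \<Rightarrow> 'a) \<Rightarrow> bool" where
  "colored c \<chi> A D p \<longleftrightarrow> (c \<longrightarrow> (\<forall>y\<in>A. \<chi> (p y) \<noteq> \<chi> y \<longleftrightarrow> y \<in> D))"

lemma symp_edge_ok: "symp (edge_ok c \<chi>)"
  by (auto simp: symp_def edge_ok_def)

text \<open>The new image of \<open>a\<close> is \<open>p x\<close>, whose color is opposite to that
  of \<open>x\<close> and hence equal to that of \<open>a\<close>; likewise for \<open>x\<close>. So
  both points stop changing color just as they leave \<open>D\<close>.\<close>

lemma colored_transpose:
  assumes "colored c \<chi> A D p" "D \<subseteq> A" "a \<in> D" "x \<in> D" "edge_ok c \<chi> a x"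
  shows "colored c \<chi> A (D - {a, x}) (p \<circ> transpose a x)"
  unfolding colored_def
proof (intro impI ballI)
  fix y assume c: c and y: "y \<in> A"
  have D: "\<chi> (p z) \<noteq> \<chi> z \<longleftrightarrow> z \<in> D" if "z \<in> A" for z using assms(1) c that by (simp add: colored_def)
  have "\<chi> a \<noteq> \<chi> x" using assms(5) c by (simp add: edge_ok_def)
  then show "\<chi> ((p \<circ> transpose a x) y) \<noteq> \<chi> y \<longleftrightarrow> y \<in> D - {a, x}"
    using D[of a] D[of x] D[OF y] assms(2-4) by (cases "y = a"; cases "y = x") auto
qed

lemma toggles_on_cycle:
  assumes "colored True \<chi> A D p" "C \<subseteq> A"
  shows "{y \<in> C. \<chi> (p y) \<noteq> \<chi> y} = D \<inter> C"
  using assms by (auto simp: colored_def)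

lemma orbit_subset_domain:
  assumes "p permutes A" "y \<in> A"
  shows "orbit p y \<subseteq> A"
  using assms by (rule permutes_orbit_subset)

text \<open>The points of \<open>D\<close> on the cycle are its color changes, and by
  \<open>card_toggles\<close> half of them start from the color opposite to that of
  \<open>a\<close>.\<close>

lemma card_same_color_opposite:
  assumes p: "p permutes A" "finite A" and col: "colored c \<chi> A D p" and y: "y \<in> A"
  shows "card {x \<in> D \<inter> orbit p y. edge_ok c \<chi> a x} = half c (card (D \<inter> orbit p y))"
proof (cases c)
  case True
  have perm: "permutation p" using p by (auto simp: permutation_permutes)
  have T: "{z \<in> orbit p y. \<chi> (p z) \<noteq> \<chi> z} = D \<inter> orbit p y"
    using toggles_on_cycle[OF _ orbit_subset_domain[OF p(1) y]] col True by simp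
  have "{x \<in> D \<inter> orbit p y. edge_ok c \<chi> a x} = {z \<in> orbit p y. \<chi> (p z) \<noteq> \<chi> z \<and> \<chi> z = (\<not> \<chi> a)}"
    unfolding T[symmetric] using True by (auto simp: edge_ok_def)
  then show ?thesis
    using card_toggles[OF bij_betw_orbit[OF perm, of y] finite_orbit[OF permutation_self_in_orbit[OF perm]],
        of \<chi> "\<not> \<chi> a"] True
    unfolding T half_def by simp
qed (simp add: half_def edge_ok_def Int_def)

lemma even_card_cycle:
  assumes p: "p permutes A" "finite A" and col: "colored True \<chi> A D p" and y: "y \<in> A"
  shows "even (card (D \<inter> orbit p y))"
proof -
  have perm: "permutation p" using p by (auto simp: permutation_permutes)
  show ?thesis
    using card_toggles[OF bij_betw_orbit[OF perm, of y] finite_orbit[OF permutation_self_in_orbit[OF perm]],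
        of \<chi> True]
    unfolding toggles_on_cycle[OF col orbit_subset_domain[OF p(1) y]] by simp
qed

context
  fixes p :: "'a \<Rightarrow> 'a" and A D :: "'a set" and a x :: 'a
  assumes p: "p permutes A" and A: "finite A" "D \<subseteq> A"
    and a: "a \<in> D" and x: "x \<in> D \<inter> orbit p a - {a}"
begin

lemma card_split:
  "card (D \<inter> orbit p a) = card ((D - {a, x}) \<inter> orbit (p \<circ> transpose a x) a) +
    card ((D - {a, x}) \<inter> orbit (p \<circ> transpose a x) x) + 2"
proof -
  have perm: "permutation p" using p A by (auto simp: permutation_permutes)
  let ?q = "p \<circ> transpose a x"
  have x': "x \<in> orbit p a" "x \<noteq> a" "x \<in> D" using x by auto
  have fin: "finite (D \<inter> orbit p a)" using rev_finite_subset[OF A] by simp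
  have "card (D \<inter> orbit p a) = Suc (Suc (card (D \<inter> orbit p a - {a, x})))"
    using fin a x' permutation_self_in_orbit[OF perm, of a] by (intro card_remove_pair) auto
  also have "D \<inter> orbit p a - {a, x} = ((D - {a, x}) \<inter> orbit ?q a) \<union> ((D - {a, x}) \<inter> orbit ?q x)"
    using orbit_split(2)[OF perm x'(1,2)] by auto
  also have "card \<dots> = card ((D - {a, x}) \<inter> orbit ?q a) + card ((D - {a, x}) \<inter> orbit ?q x)"
    using rev_finite_subset[OF A] orbit_split(3)[OF perm x'(1,2)] by (intro card_Un_disjoint) auto
  finally show ?thesis by simp
qed

text \<open>As \<open>a\<close> and \<open>x\<close> have the same color, \<open>x\<close>, now
  mapped to \<open>p a\<close>, still changes color. So the color changes on the new cycle of
  \<open>x\<close> are its points of \<open>D\<close>, including \<open>x\<close>; their number is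
  even, hence odd without \<open>x\<close>. The other part follows from the parity of the whole
  cycle.\<close>

lemma odd_split:
  assumes col: "colored c \<chi> A D p" and ax: "\<not> edge_ok c \<chi> a x"
  shows "odd (card ((D - {a, x}) \<inter> orbit (p \<circ> transpose a x) x))"
    and "odd (card ((D - {a, x}) \<inter> orbit (p \<circ> transpose a x) a))"
proof -
  have perm: "permutation p" using p A by (auto simp: permutation_permutes)
  let ?q = "p \<circ> transpose a x"
  have c: c and ax': "\<chi> a = \<chi> x" using ax by (auto simp: edge_ok_def)
  have col': "colored True \<chi> A D p" using col c by simp
  have x': "x \<in> orbit p a" "x \<noteq> a" "x \<in> D" using x by auto
  have q: "permutation ?q" by (rule permutation_compose_transpose[OF perm])
  have G: "orbit ?q x \<subseteq> A"
    using orbit_split(2)[OF perm x'(1,2)] orbit_subset_domain[OF p, of a] a A by blast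
  have aG: "a \<notin> orbit ?q x" by (rule orbit_split(1)[OF perm x'(1,2)])
  have xG: "x \<in> orbit ?q x" by (rule permutation_self_in_orbit[OF q])
  have D: "\<chi> (p z) \<noteq> \<chi> z \<longleftrightarrow> z \<in> D" if "z \<in> A" for z using col' that by (simp add: colored_def)
  have "\<chi> (?q y) \<noteq> \<chi> y \<longleftrightarrow> y \<in> D" if y: "y \<in> orbit ?q x" for y
    using D[of y] D[of a] ax' a x' A aG G y by (cases "y = x") (auto simp: transpose_def)
  then have "{y \<in> orbit ?q x. \<chi> (?q y) \<noteq> \<chi> y} = D \<inter> orbit ?q x" by blast
  moreover have "D \<inter> orbit ?q x = insert x ((D - {a, x}) \<inter> orbit ?q x)" using aG xG x' by auto
  moreover have "finite ((D - {a, x}) \<inter> orbit ?q x)" using rev_finite_subset[OF A] by simp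
  ultimately have "card {y \<in> orbit ?q x. \<chi> (?q y) \<noteq> \<chi> y} = Suc (card ((D - {a, x}) \<inter> orbit ?q x))" by simp
  moreover have "even (card {y \<in> orbit ?q x. \<chi> (?q y) \<noteq> \<chi> y})"
    by (subst card_toggles[OF bij_betw_orbit[OF q] finite_orbit[OF xG], where b = True]) simp
  ultimately show 1: "odd (card ((D - {a, x}) \<inter> orbit ?q x))" by simp
  have "even (card (D \<inter> orbit p a))" using a A by (intro even_card_cycle[OF p A(1) col']) auto
  then show "odd (card ((D - {a, x}) \<inter> orbit ?q a))" using 1 unfolding card_split by simp
qed

end

lemma permutes_compose_transpose:
  assumes "p permutes A" "a \<in> A" "x \<in> A"
  shows "(p \<circ> transpose a x) permutes A"
  using assms by (intro permutes_compose permutes_swap_id)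

text \<open>Edges within a cycle that violate the coloring contribute nothing, because \<^const>\<open>cat\<close>
  vanishes at odd arguments; hence the colored sum can be extended to all edges.\<close>

lemma sum_within_cycle:
  fixes f :: "nat \<Rightarrow> nat \<Rightarrow> nat"
  assumes p: "p permutes A" and A: "finite A" "D \<subseteq> A" and a: "a \<in> D"
    and col: "colored c \<chi> A D p"
    and f: "\<And>i j. odd i \<Longrightarrow> odd j \<Longrightarrow> f i j = 0"
    and m: "card (D \<inter> orbit p a) = Suc m"
  shows "(\<Sum>x | x \<in> D \<inter> orbit p a - {a} \<and> edge_ok c \<chi> a x.
      f (card ((D - {a, x}) \<inter> orbit (p \<circ> transpose a x) x))
        (card ((D - {a, x}) \<inter> orbit (p \<circ> transpose a x) a))) = (\<Sum>i<m. f i (m - 1 - i))"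
proof -
  let ?X = "D \<inter> orbit p a - {a}"
  let ?i = "\<lambda>x. card ((D - {a, x}) \<inter> orbit (p \<circ> transpose a x) x)"
  let ?j = "\<lambda>x. card ((D - {a, x}) \<inter> orbit (p \<circ> transpose a x) a)"
  have perm: "permutation p" using p A by (auto simp: permutation_permutes)
  have fin: "finite ?X" using rev_finite_subset[OF A] by simp
  have j: "?j x = m - 1 - ?i x" if "x \<in> ?X" for x
    using card_split[OF p A a that] m by simp
  have "(\<Sum>x | x \<in> ?X \<and> edge_ok c \<chi> a x. f (?i x) (?j x)) = (\<Sum>x\<in>?X. f (?i x) (?j x))"
  proof (rule sum.mono_neutral_left[OF fin])
    show "\<forall>x\<in>?X - {x. x \<in> ?X \<and> edge_ok c \<chi> a x}. f (?i x) (?j x) = 0"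
    proof
      fix x assume "x \<in> ?X - {x. x \<in> ?X \<and> edge_ok c \<chi> a x}"
      then have "x \<in> ?X" "\<not> edge_ok c \<chi> a x" by auto
      then show "f (?i x) (?j x) = 0" using odd_split[OF p A a _ col] by (intro f)
    qed
  qed auto
  also have "\<dots> = (\<Sum>x\<in>?X. f (?i x) (m - 1 - ?i x))"
    using j by (intro sum.cong) simp_all
  also have "\<dots> = (\<Sum>i\<in>{..<card (D \<inter> orbit p a) - 1}. f i (m - 1 - i))"
    by (rule sum.reindex_bij_betw[OF bij_betw_split_card[OF perm a]])
  finally show ?thesis by (simp add: m)
qed

lemma remove_pair_Int_other_cycle:
  assumes p: "permutation p" and C: "C \<in> cycles_on A p" "C \<noteq> orbit p a" "C \<noteq> orbit p x"
  shows "(D - {a, x}) \<inter> C = D \<inter> C"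
proof -
  have "a \<notin> C" "x \<notin> C" using orbit_of_cycle[OF p C(1)] C(2,3) by auto
  then show ?thesis by auto
qed

lemma sum_cycle_filter:
  assumes "finite D"
  shows "(\<Sum>x | x \<in> D - {a} \<and> P x. if x \<in> C then f x else (0::nat)) =
    (\<Sum>x | x \<in> D \<inter> C - {a} \<and> P x. f x)"
proof -
  have fin: "finite {x. x \<in> D - {a} \<and> P x}" using assms by simp
  have "{x \<in> {x. x \<in> D - {a} \<and> P x}. x \<in> C} = {x. x \<in> D \<inter> C - {a} \<and> P x}" by auto
  then show ?thesis using sum.inter_filter[OF fin, of f "\<lambda>x. x \<in> C"] by simp
qed

text \<open>Only splits occur, so points are paired within cycles, noncrossing on each. The product
  over all cycles is the form that carries the induction, since deletions create cycles; a cycle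
  without points of \<open>D\<close> contributes \<open>cat 0 = 1\<close>.\<close>

lemma card_planar:
  assumes "p permutes A" "finite A" "D \<subseteq> A" "colored c \<chi> A D p"
  shows "card {\<iota> \<in> pairings (edge_ok c \<chi>) D. planar A D p \<iota>} =
    (\<Prod>C\<in>cycles_on A p. cat (card (D \<inter> C)))"
  using assms
proof (induction "card D" arbitrary: D p rule: less_induct)
  case less
  note p = less.prems(1) and A = less.prems(2,3) and col = less.prems(4)
  have perm: "permutation p" using p A by (auto simp: permutation_permutes)
  have D: "finite D" by (rule rev_finite_subset[OF A])
  show ?case
  proof (cases "D = {}")
    case True
    then have "{\<iota> \<in> pairings (edge_ok c \<chi>) D. planar A D p \<iota>} = {id}"
      by (auto simp: pairings_empty planar_def)
    then show ?thesis using True by simp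
  next
    case False
    then obtain a where a: "a \<in> D" by blast
    let ?C = "orbit p a" and ?q = "\<lambda>x. p \<circ> transpose a x"
    define W where "W = (\<Prod>C\<in>cycles_on A p - {?C}. cat (card (D \<inter> C)))"
    have CA: "?C \<in> cycles_on A p" using a A by (auto simp: cycles_on_def)
    have "a \<in> D \<inter> ?C" using a permutation_self_in_orbit[OF perm] by simp
    then obtain m where m: "card (D \<inter> ?C) = Suc m" using D by (cases "card (D \<inter> ?C)") auto
    have step: "card {\<kappa> \<in> pairings (edge_ok c \<chi>) (D - {a, x}). planar A D p (transpose a x \<circ> \<kappa>)} =
        (if x \<in> ?C then cat (card ((D - {a, x}) \<inter> orbit (?q x) x)) *
           cat (card ((D - {a, x}) \<inter> orbit (?q x) a)) * W else 0)"
      if x: "x \<in> {x. x \<in> D - {a} \<and> edge_ok c \<chi> a x}" for x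
    proof -
      have xD: "x \<in> D" "x \<noteq> a" and ok: "edge_ok c \<chi> a x" using x by auto
      have aA: "a \<in> A" "x \<in> A" using a xD A by auto
      let ?D = "D - {a, x}"
      have "{\<kappa> \<in> pairings (edge_ok c \<chi>) ?D. planar A D p (transpose a x \<circ> \<kappa>)} =
          {\<kappa> \<in> pairings (edge_ok c \<chi>) ?D. x \<in> ?C \<and> planar A ?D (?q x) \<kappa>}"
        using planar_transpose_iff[OF perm A a xD] by (intro Collect_cong) blast
      moreover have "card {\<kappa> \<in> pairings (edge_ok c \<chi>) ?D. planar A ?D (?q x) \<kappa>} =
          cat (card (?D \<inter> orbit (?q x) x)) * cat (card (?D \<inter> orbit (?q x) a)) * W"
        if xC: "x \<in> ?C"
      proof -
        have "card {\<kappa> \<in> pairings (edge_ok c \<chi>) ?D. planar A ?D (?q x) \<kappa>} =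
            (\<Prod>C\<in>cycles_on A (?q x). cat (card (?D \<inter> C)))"
        proof (rule less.hyps)
          show "card ?D < card D" using card_remove_pair[OF D a xD] by simp
        qed (use A in \<open>auto intro: permutes_compose_transpose[OF p aA] colored_transpose[OF col A(2) a xD(1) ok]\<close>)
        also have "\<dots> = cat (card (?D \<inter> orbit (?q x) a)) * (cat (card (?D \<inter> orbit (?q x) x)) *
            (\<Prod>C\<in>cycles_on A p - {?C}. cat (card (?D \<inter> C))))"
          using cycles_split[OF perm aA xC xD(2)] finite_cycles_on[OF A(1), of p] by simp
        also have "(\<Prod>C\<in>cycles_on A p - {?C}. cat (card (?D \<inter> C))) = W"
          unfolding W_def using xC
          by (intro prod.cong refl arg_cong[where f = "\<lambda>X. cat (card X)"] remove_pair_Int_other_cycle[OF perm])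
            (auto simp: mem_orbit_iff[OF perm])
        finally show ?thesis by (simp only: ac_simps)
      qed
      ultimately show ?thesis by auto
    qed
    have "card {\<iota> \<in> pairings (edge_ok c \<chi>) D. planar A D p \<iota>} =
        (\<Sum>x | x \<in> D - {a} \<and> edge_ok c \<chi> a x.
          card {\<kappa> \<in> pairings (edge_ok c \<chi>) (D - {a, x}). planar A D p (transpose a x \<circ> \<kappa>)})"
      by (rule card_pairings_rec[OF D a symp_edge_ok])
    also have "\<dots> = (\<Sum>x | x \<in> D \<inter> ?C - {a} \<and> edge_ok c \<chi> a x.
        cat (card ((D - {a, x}) \<inter> orbit (?q x) x)) * cat (card ((D - {a, x}) \<inter> orbit (?q x) a)) * W)"
      unfolding sum_cycle_filter[OF D, symmetric] by (rule sum.cong[OF refl step])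
    also have "\<dots> = (\<Sum>i<m. cat i * cat (m - 1 - i) * W)"
      by (rule sum_within_cycle[OF p A a col _ m, where f = "\<lambda>i j. cat i * cat j * W"]) (simp add: cat_odd)
    also have "\<dots> = cat (card (D \<inter> ?C)) * W" by (simp add: m cat.simps sum_distrib_right)
    also have "\<dots> = (\<Prod>C\<in>cycles_on A p. cat (card (D \<inter> C)))"
      unfolding W_def by (rule prod.remove[OF finite_cycles_on[OF A(1)] CA, symmetric])
    finally show ?thesis .
  qed
qed

section \<open>Matchings with a single merge\<close>

text \<open>The substitute for connectivity when there are more than two cycles: the one merge takes
  place between \<open>F\<close> and \<open>G\<close>, while the other cycles carry planar matchings
  of their own.\<close>

definition annular :: "'a set \<Rightarrow> 'a set \<Rightarrow> ('a \<Rightarrow> 'a) \<Rightarrow> 'a set \<Rightarrow> 'a set \<Rightarrow> ('a \<Rightarrow> 'a) \<Rightarrow> bool" where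
  "annular A D p F G \<iota> \<longleftrightarrow> deficient A D p \<iota> \<and> (\<exists>y\<in>F. \<iota> y \<in> G)"

text \<open>When a face splits into \<open>F\<close> and \<open>F'\<close>, edges to
  \<open>G\<close> start in at most one of them, since a deficient matching joins only one pair of
  cycles. This makes the two outcomes of a split disjoint.\<close>

lemma annular_exclusive:
  assumes p: "permutation p" and A: "finite A" "D \<subseteq> A" and \<iota>: "\<iota> \<in> pairings R D"
    and cyc: "F \<in> cycles_on A p" "F' \<in> cycles_on A p" "G \<in> cycles_on A p"
    and ne: "F \<noteq> F'" "F \<noteq> G" "F' \<noteq> G"
  shows "\<not> (annular A D p F G \<iota> \<and> annular A D p F' G \<iota>)"
proof
  assume "annular A D p F G \<iota> \<and> annular A D p F' G \<iota>"
  then obtain y w where def: "deficient A D p \<iota>" and y: "y \<in> F" "\<iota> y \<in> G" and w: "w \<in> F'" "\<iota> w \<in> G"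
    by (auto simp: annular_def)
  have orb: "orbit p y = F" "orbit p w = F'" "orbit p (\<iota> y) = G" "orbit p (\<iota> w) = G"
    using y w orbit_of_cycle[OF p] cyc by auto
  have "\<iota> y \<notin> orbit p y" "\<iota> w \<notin> orbit p w"
    using mem_orbit_iff[OF p, of "\<iota> y" y] mem_orbit_iff[OF p, of "\<iota> w" w] orb ne by simp_all
  then show False
    using deficient_joins_two_cycles[OF p A \<iota> def, of y w] orb ne by simp
qed

text \<open>Induction with \<open>G\<close> fixed and \<open>F\<close> shrinking. The partner of a
  point of \<open>F\<close> lies in \<open>F\<close>, which splits and leaves exactly one part
  joined to \<open>G\<close>; or in \<open>G\<close>, which merges the two and leaves a planar rest;
  or in a third cycle, which is impossible.\<close>

lemma card_annular:
  assumes "p permutes A" "finite A" "D \<subseteq> A" "colored c \<chi> A D p"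
    and "F \<in> cycles_on A p" "G \<in> cycles_on A p" "F \<noteq> G"
  shows "card {\<iota> \<in> pairings (edge_ok c \<chi>) D. annular A D p F G \<iota>} =
    ann c (card (D \<inter> F)) (card (D \<inter> G)) * (\<Prod>C\<in>cycles_on A p - {F, G}. cat (card (D \<inter> C)))"
  using assms
proof (induction "card D" arbitrary: D p F rule: less_induct)
  case less
  note p = less.prems(1) and A = less.prems(2,3) and col = less.prems(4) and FG = less.prems(5-7)
  have perm: "permutation p" using p A by (auto simp: permutation_permutes)
  have D: "finite D" by (rule rev_finite_subset[OF A])
  have disj: "F \<inter> G = {}" by (rule cycles_on_disjoint[OF perm FG])
  let ?P = "pairings (edge_ok c \<chi>)"
  show ?case
  proof (cases "D \<inter> F = {}")
    case True
    have "\<not> annular A D p F G \<iota>" if \<iota>: "\<iota> \<in> ?P D" for \<iota>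
    proof
      assume "annular A D p F G \<iota>"
      then obtain y where "y \<in> F" "\<iota> y \<in> G" by (auto simp: annular_def)
      moreover from this have "\<iota> y = y" using True by (intro pairings_outside[OF \<iota>]) auto
      ultimately show False using disj by auto
    qed
    then have "{\<iota> \<in> ?P D. annular A D p F G \<iota>} = {}" by auto
    then show ?thesis using True by (simp only: card.empty ann.simps mult_zero_left)
  next
    case False
    then obtain a where a: "a \<in> D" "a \<in> F" by auto
    have F: "orbit p a = F" by (rule orbit_of_cycle[OF perm FG(1) a(2)])
    obtain m where m: "card (D \<inter> F) = Suc m" using False D by (cases "card (D \<inter> F)") auto
    let ?q = "\<lambda>x. p \<circ> transpose a x" and ?n = "card (D \<inter> G)"
    let ?R = "cycles_on A p - {F, G}"
    define W where "W = (\<Prod>C\<in>?R. cat (card (D \<inter> C)))"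
    define f where "f i j = (ann c i ?n * cat j + cat i * ann c j ?n) * W" for i j
    have finR: "finite ?R" using finite_cycles_on[OF A(1)] by simp
    have step: "card {\<kappa> \<in> ?P (D - {a, x}). annular A D p F G (transpose a x \<circ> \<kappa>)} =
        (if x \<in> F then f (card ((D - {a, x}) \<inter> orbit (?q x) x)) (card ((D - {a, x}) \<inter> orbit (?q x) a)) else 0) +
        (if x \<in> G then cat (m + ?n - 1) * W else 0)"
      if x: "x \<in> {x. x \<in> D - {a} \<and> edge_ok c \<chi> a x}" for x
    proof -
      have xD: "x \<in> D" "x \<noteq> a" and ok: "edge_ok c \<chi> a x" using x by auto
      have aA: "a \<in> A" "x \<in> A" using a xD A by auto
      let ?D = "D - {a, x}"
      have less_D: "card ?D < card D" using card_remove_pair[OF D a(1) xD] by simp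
      have D': "?D \<subseteq> A" using A by auto
      have q: "?q x permutes A" by (rule permutes_compose_transpose[OF p aA])
      have permq: "permutation (?q x)" by (rule permutation_compose_transpose[OF perm])
      have colq: "colored c \<chi> A ?D (?q x)" by (rule colored_transpose[OF col A(2) a(1) xD(1) ok])
      note def_iff = deficient_transpose_iff[OF perm A a(1) xD, unfolded F]
      have W: "(\<Prod>C\<in>?R. cat (card (?D \<inter> C))) = W" if "orbit p x = F \<or> orbit p x = G"
        unfolding W_def using that F
        by (intro prod.cong refl arg_cong[where f = "\<lambda>X. cat (card X)"] remove_pair_Int_other_cycle[OF perm]) auto
      consider (F) "x \<in> F" | (G) "x \<in> G" | (other) "x \<notin> F" "x \<notin> G" by blast
      then show ?thesis
      proof cases
        case F': F
        have xG: "x \<notin> G" using F' disj by auto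
        have xp: "x \<in> orbit p a" using F' F by simp
        have orb_x: "orbit p x = F" by (rule orbit_of_cycle[OF perm FG(1) F'])
        let ?Fa = "orbit (?q x) a" and ?Fx = "orbit (?q x) x"
        note cyc = cycles_split[OF perm aA xp xD(2), unfolded F]
        have G_in: "G \<in> cycles_on A p - {F}" using FG by auto
        have mem: "?Fa \<in> cycles_on A (?q x)" "?Fx \<in> cycles_on A (?q x)" "G \<in> cycles_on A (?q x)"
          using cyc(1) G_in by auto
        have ne: "?Fa \<noteq> G" "?Fx \<noteq> G" using cyc(3,4) G_in by auto
        have Un: "?Fa \<union> ?Fx = F" using orbit_split(2)[OF perm xp xD(2)] F by simp
        have DG: "?D \<inter> G = D \<inter> G" using a xG disj by auto
        have iff: "annular A D p F G (transpose a x \<circ> \<kappa>) \<longleftrightarrow>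
            annular A ?D (?q x) ?Fa G \<kappa> \<or> annular A ?D (?q x) ?Fx G \<kappa>" if \<kappa>: "\<kappa> \<in> ?P ?D" for \<kappa>
        proof -
          have "(transpose a x \<circ> \<kappa>) y \<in> G \<longleftrightarrow> \<kappa> y \<in> G" for y
            using a xG F' disj by (auto simp: transpose_def)
          moreover have "(\<exists>y\<in>F. \<kappa> y \<in> G) \<longleftrightarrow> (\<exists>y\<in>?Fa. \<kappa> y \<in> G) \<or> (\<exists>y\<in>?Fx. \<kappa> y \<in> G)"
            unfolding Un[symmetric] by (rule bex_Un)
          ultimately show ?thesis using def_iff[OF \<kappa>] F' by (simp only: annular_def if_True) argo
        qed
        have "{\<kappa> \<in> ?P ?D. annular A D p F G (transpose a x \<circ> \<kappa>)} =
            {\<kappa> \<in> ?P ?D. annular A ?D (?q x) ?Fa G \<kappa>} \<union> {\<kappa> \<in> ?P ?D. annular A ?D (?q x) ?Fx G \<kappa>}"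
          using iff by blast
        moreover have "{\<kappa> \<in> ?P ?D. annular A ?D (?q x) ?Fa G \<kappa>} \<inter> {\<kappa> \<in> ?P ?D. annular A ?D (?q x) ?Fx G \<kappa>} = {}"
          using annular_exclusive[OF permq A(1) D' _ mem cyc(2) ne] by blast
        moreover have "finite (?P ?D)" using D by (intro finite_pairings) simp
        ultimately have "card {\<kappa> \<in> ?P ?D. annular A D p F G (transpose a x \<circ> \<kappa>)} =
            card {\<kappa> \<in> ?P ?D. annular A ?D (?q x) ?Fa G \<kappa>} + card {\<kappa> \<in> ?P ?D. annular A ?D (?q x) ?Fx G \<kappa>}"
          by (simp add: card_Un_disjoint)
        also have "card {\<kappa> \<in> ?P ?D. annular A ?D (?q x) ?Fa G \<kappa>} =
            ann c (card (?D \<inter> ?Fa)) ?n * (cat (card (?D \<inter> ?Fx)) * W)"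
        proof -
          have "cycles_on A (?q x) - {?Fa, G} = insert ?Fx ?R" using cyc ne by auto
          moreover have "?Fx \<notin> ?R" using cyc(4) by auto
          ultimately show ?thesis
            using less.hyps[OF less_D q A(1) D' colq mem(1,3) ne(1)] W orb_x finR by (simp add: DG)
        qed
        also have "card {\<kappa> \<in> ?P ?D. annular A ?D (?q x) ?Fx G \<kappa>} =
            ann c (card (?D \<inter> ?Fx)) ?n * (cat (card (?D \<inter> ?Fa)) * W)"
        proof -
          have "cycles_on A (?q x) - {?Fx, G} = insert ?Fa ?R" using cyc ne by auto
          moreover have "?Fa \<notin> ?R" using cyc(3) by auto
          ultimately show ?thesis
            using less.hyps[OF less_D q A(1) D' colq mem(2,3) ne(2)] W orb_x finR by (simp add: DG)
        qed
        also have "ann c (card (?D \<inter> ?Fa)) ?n * (cat (card (?D \<inter> ?Fx)) * W) +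
            ann c (card (?D \<inter> ?Fx)) ?n * (cat (card (?D \<inter> ?Fa)) * W) =
            f (card (?D \<inter> ?Fx)) (card (?D \<inter> ?Fa))"
          by (simp only: f_def distrib_right distrib_left ac_simps)
        finally show ?thesis using F' xG by (simp only: if_True if_False add_0_right)
      next
        case G
        have xF: "x \<notin> F" using G disj by auto
        have xp: "x \<notin> orbit p a" using xF F by simp
        have orb_x: "orbit p x = G" by (rule orbit_of_cycle[OF perm FG(2) G])
        have "annular A D p F G (transpose a x \<circ> \<kappa>) \<longleftrightarrow> planar A ?D (?q x) \<kappa>" if \<kappa>: "\<kappa> \<in> ?P ?D" for \<kappa>
        proof -
          have "(transpose a x \<circ> \<kappa>) a = x" using pairings_outside[OF \<kappa>, of a] by simp
          then have "\<exists>y\<in>F. (transpose a x \<circ> \<kappa>) y \<in> G" using a G by (intro bexI[of _ a]) simp_all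
          then show ?thesis using def_iff[OF \<kappa>] xF by (simp add: annular_def)
        qed
        then have "{\<kappa> \<in> ?P ?D. annular A D p F G (transpose a x \<circ> \<kappa>)} = {\<kappa> \<in> ?P ?D. planar A ?D (?q x) \<kappa>}"
          by (intro Collect_cong) blast
        moreover have "card {\<kappa> \<in> ?P ?D. planar A ?D (?q x) \<kappa>} = (\<Prod>C\<in>cycles_on A (?q x). cat (card (?D \<inter> C)))"
          by (rule card_planar[OF q A(1) D' colq])
        moreover have cyc: "cycles_on A (?q x) = insert (F \<union> G) ?R"
          using cycles_merge[OF perm aA xp] unfolding F orb_x .
        moreover have "F \<union> G \<notin> ?R"
        proof
          assume "F \<union> G \<in> ?R"
          then have "orbit p a = F \<union> G" using a(2) by (intro orbit_of_cycle[OF perm]) auto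
          then show False using F G xF by auto
        qed
        moreover have "card (?D \<inter> (F \<union> G)) = m + ?n - 1"
        proof -
          have "?D \<inter> (F \<union> G) = (D \<inter> F - {a}) \<union> (D \<inter> G - {x})" using a G disj by auto
          moreover have "(D \<inter> F - {a}) \<inter> (D \<inter> G - {x}) = {}" using disj by auto
          ultimately have "card (?D \<inter> (F \<union> G)) = card (D \<inter> F - {a}) + card (D \<inter> G - {x})"
            using D by (simp add: card_Un_disjoint)
          also have "card (D \<inter> F - {a}) = m" using a m by (simp add: card_Diff_singleton)
          also have "card (D \<inter> G - {x}) = ?n - 1" using xD G by (simp add: card_Diff_singleton)
          \<comment> \<open>\<open>x\<close> lies in \<open>D \<inter> G\<close>, so
            \<open>?n\<close> is positive and \<open>m + (?n - 1)\<close> equals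
            \<open>m + ?n - 1\<close> despite truncation.\<close>
          finally show ?thesis using xD G D card_gt_0_iff[of "D \<inter> G"] by auto
        qed
        ultimately show ?thesis using G xF W orb_x finR by simp
      next
        case other
        \<comment> \<open>The edge from \<open>a\<close> to \<open>x\<close> and an edge from
          \<open>F\<close> to \<open>G\<close> must join the same two cycles, which would put
          \<open>x\<close> into \<open>G\<close>.\<close>
        have "\<not> annular A D p F G (transpose a x \<circ> \<kappa>)" if \<kappa>: "\<kappa> \<in> ?P ?D" for \<kappa>
        proof
          let ?\<iota> = "transpose a x \<circ> \<kappa>"
          assume ann: "annular A D p F G ?\<iota>"
          then obtain y where y: "y \<in> F" "?\<iota> y \<in> G" by (auto simp: annular_def)
          have \<iota>: "?\<iota> \<in> ?P D" and \<iota>a: "?\<iota> a = x"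
            using pairings_insert[OF a(1) xD ok _ \<kappa>] sympD[OF symp_edge_ok ok] by auto
          define z where "z = ?\<iota> y"
          have orb: "orbit p y = F" "orbit p z = G" "orbit p a = F"
            using y orbit_of_cycle[OF perm] FG F by (auto simp: z_def)
          have ne: "y \<noteq> z" using y disj by (auto simp: z_def)
          then have "y \<in> D" using pairings_outside[OF \<iota>, of y] by (auto simp: z_def)
          then have \<iota>z: "?\<iota> z = y" using \<iota> by (auto simp: z_def pairings_def)
          have def: "deficient A D p ?\<iota>" using ann by (simp only: annular_def)
          have bridge: "?\<iota> a \<notin> orbit p a" "?\<iota> z \<notin> orbit p z"
            unfolding \<iota>a \<iota>z orb using other(1) y(1) disj by blast+
          have "orbit p x = G"
            using deficient_joins_two_cycles[OF perm A \<iota> def bridge] FG(3) unfolding \<iota>a orb by simp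
          then show False using other(2) permutation_self_in_orbit[OF perm, of x] by simp
        qed
        then have "{\<kappa> \<in> ?P ?D. annular A D p F G (transpose a x \<circ> \<kappa>)} = {}" by blast
        then show ?thesis using other by (simp only: card.empty if_False add_0)
      qed
    qed
    let ?X = "{x. x \<in> D - {a} \<and> edge_ok c \<chi> a x}"
    have "card {\<iota> \<in> ?P D. annular A D p F G \<iota>} =
        (\<Sum>x\<in>?X. card {\<kappa> \<in> ?P (D - {a, x}). annular A D p F G (transpose a x \<circ> \<kappa>)})"
      by (rule card_pairings_rec[OF D a(1) symp_edge_ok])
    also have "\<dots> = (\<Sum>x\<in>?X. (if x \<in> F then f (card ((D - {a, x}) \<inter> orbit (?q x) x))
          (card ((D - {a, x}) \<inter> orbit (?q x) a)) else 0) + (if x \<in> G then cat (m + ?n - 1) * W else 0))"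
      by (rule sum.cong[OF refl step])
    also have "\<dots> = (\<Sum>x | x \<in> D \<inter> F - {a} \<and> edge_ok c \<chi> a x.
          f (card ((D - {a, x}) \<inter> orbit (?q x) x)) (card ((D - {a, x}) \<inter> orbit (?q x) a))) +
        (\<Sum>x | x \<in> D \<inter> G - {a} \<and> edge_ok c \<chi> a x. cat (m + ?n - 1) * W)"
      unfolding sum.distrib sum_cycle_filter[OF D] by (rule refl)
    also have "(\<Sum>x | x \<in> D \<inter> F - {a} \<and> edge_ok c \<chi> a x.
          f (card ((D - {a, x}) \<inter> orbit (?q x) x)) (card ((D - {a, x}) \<inter> orbit (?q x) a))) =
        (\<Sum>i<m. f i (m - 1 - i))"
      using sum_within_cycle[OF p A a(1) col, of f m] m unfolding F by (simp add: f_def cat_odd)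
    also have "\<dots> = (\<Sum>i<m. ann c i ?n * cat (m - 1 - i) + cat i * ann c (m - 1 - i) ?n) * W"
      by (simp add: f_def sum_distrib_right)
    also have "(\<Sum>x | x \<in> D \<inter> G - {a} \<and> edge_ok c \<chi> a x. cat (m + ?n - 1) * W) =
        half c ?n * (cat (m + ?n - 1) * W)"
    proof -
      obtain y where y: "y \<in> A" "G = orbit p y" using FG(2) by (auto simp: cycles_on_def)
      have "{x. x \<in> D \<inter> G - {a} \<and> edge_ok c \<chi> a x} = {x \<in> D \<inter> G. edge_ok c \<chi> a x}"
        using a disj by auto
      then show ?thesis using card_same_color_opposite[OF p A(1) col y(1), of a] y by simp
    qed
    finally show ?thesis
      by (simp add: m ann.simps W_def algebra_simps)
  qed
qed

section \<open>Generating functions\<close>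

text \<open>Reflecting \<open>i\<close> to \<open>m - 1 - i\<close> identifies the two halves of the
  sum; this is the origin of the 2 in the coefficient 1 - 2 Y.\<close>

lemma ann_Suc: "ann c (Suc m) n = half c n * cat (m + n - 1) + 2 * (\<Sum>i<m. cat i * ann c (m - 1 - i) n)"
proof -
  have "(\<Sum>i<m. ann c i n * cat (m - 1 - i)) = (\<Sum>i<m. cat i * ann c (m - 1 - i) n)"
    by (subst sum.nat_diff_reindex[symmetric]) (auto intro!: sum.cong simp: mult.commute)
  then show ?thesis by (simp add: ann.simps sum.distrib)
qed

lemma ann_0_right: "ann c m 0 = 0"
  by (induction m rule: less_induct) (case_tac x; simp add: ann_Suc half_def)

definition ann_total :: "bool \<Rightarrow> nat \<Rightarrow> nat" where
  "ann_total c n = (\<Sum>k\<le>n. if c \<longrightarrow> even k \<and> even n then ann c k (n - k) else 0)"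

text \<open>The weight of the merging edges at total size \<open>n + 2\<close>: \<open>k\<close> is
  the size of the second face, at most \<open>n + 1\<close> because the first face contains the
  fixed label.\<close>

definition half_total :: "bool \<Rightarrow> nat \<Rightarrow> nat" where
  "half_total c n = (\<Sum>k\<le>Suc n. if c \<longrightarrow> even k \<and> even n then half c k else 0)"

lemma ann_total_0: "ann_total c 0 = 0"
  by (simp add: ann_total_def)

lemma ann_total_1: "ann_total c (Suc 0) = 0"
  by (simp add: ann_total_def ann_0_right)

lemma sum_triangle_swap:
  fixes f :: "nat \<Rightarrow> nat \<Rightarrow> nat"
  shows "(\<Sum>r\<le>n. \<Sum>i\<le>r. f i (r - i)) = (\<Sum>i\<le>n. \<Sum>j\<le>n - i. f i j)"
proof -
  have "{(i, j). i + j \<le> n} = Sigma {..n} (\<lambda>i. {..n - i})" by auto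
  then show ?thesis by (simp add: sum.Sigma flip: sum.triangle_reindex_eq)
qed

text \<open>A merge leaves the other \<open>n\<close> labels on one cycle whatever the face sizes
  were, so \<open>cat n\<close> factors out. A split gives a convolution, because only one of the
  two parts stays joined to the second face.\<close>

lemma ann_total_rec:
  "ann_total c (n + 2) = cat n * half_total c n + 2 * (\<Sum>i\<le>n. cat i * ann_total c (n - i))"
proof -
  define ok where "ok k = (c \<longrightarrow> even k \<and> even n)" for k :: nat
  have "ann_total c (n + 2) = (\<Sum>k\<le>Suc (Suc n). if ok k then ann c k (Suc (Suc n) - k) else 0)"
    by (simp add: ann_total_def ok_def del: sum.atMost_Suc)
  also have "\<dots> = (\<Sum>m\<le>Suc n. if ok (Suc m) then ann c (Suc m) (Suc n - m) else 0)"
    by (subst sum.atMost_Suc_shift) (simp cong: if_cong)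
  also have "\<dots> = (\<Sum>m\<le>Suc n. if ok (Suc m) then half c (Suc n - m) * cat n else 0) +
      2 * (\<Sum>m\<le>Suc n. if ok (Suc m) then \<Sum>i<m. cat i * ann c (m - 1 - i) (Suc n - m) else 0)"
    unfolding sum_distrib_left sum.distrib[symmetric]
    by (intro sum.cong refl) (simp add: ann_Suc)
  \<comment> \<open>The summation variable changes from the size of the first face, less one, to the
    size of the second.\<close>
  also have "(\<Sum>m\<le>Suc n. if ok (Suc m) then half c (Suc n - m) * cat n else 0) =
      (\<Sum>m\<le>Suc n. if ok m then half c m * cat n else 0)"
    by (rule sum.reindex_bij_witness[where i = "\<lambda>m. Suc n - m" and j = "\<lambda>m. Suc n - m"])
      (auto simp: ok_def)
  also have "\<dots> = cat n * half_total c n"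
    unfolding half_total_def ok_def sum_distrib_left by (intro sum.cong refl) simp
  also have "(\<Sum>m\<le>Suc n. if ok (Suc m) then \<Sum>i<m. cat i * ann c (m - 1 - i) (Suc n - m) else 0) =
      (\<Sum>r\<le>n. if ok r then \<Sum>i\<le>r. cat i * ann c (r - i) (n - r) else 0)"
    by (subst sum.atMost_Suc_shift) (auto simp: ok_def lessThan_Suc_atMost intro!: sum.cong)
  also have "\<dots> = (\<Sum>r\<le>n. \<Sum>i\<le>r. if ok (i + (r - i)) then cat i * ann c (r - i) (n - i - (r - i)) else 0)"
    by (intro sum.cong refl) auto
  also have "\<dots> = (\<Sum>i\<le>n. \<Sum>j\<le>n - i. if ok (i + j) then cat i * ann c j (n - i - j) else 0)"
    by (rule sum_triangle_swap)
  also have "\<dots> = (\<Sum>i\<le>n. cat i * ann_total c (n - i))"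
    unfolding ann_total_def sum_distrib_left
  proof (intro sum.cong refl)
    fix i j assume "i \<in> {..n}" "j \<in> {..n - i}"
    \<comment> \<open>The parity conditions differ only for odd \<open>i\<close>, where
      \<open>cat i\<close> vanishes.\<close>
    then show "(if ok (i + j) then cat i * ann c j (n - i - j) else 0) =
        cat i * (if c \<longrightarrow> even j \<and> even (n - i) then ann c j (n - i - j) else 0)"
      by (cases "even i") (auto simp: ok_def cat_odd)
  qed
  finally show ?thesis .
qed

section \<open>Power series and their closed forms\<close>

unbundle fps_syntax

text \<open>The extra edge turns C = 1 + t^2 C^2 into Y = t^2 + Y^2 for Y = t^2 C, and moves
  \<open>cat n\<close> to the power \<open>n + 2\<close>, where it meets the recurrence of
  \<open>ann_total\<close>.\<close>

definition cat_fps :: "real fps" where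
  "cat_fps = fps_X\<^sup>2 * Abs_fps (\<lambda>n. real (cat n))"

definition ann_fps :: "bool \<Rightarrow> real fps" where
  "ann_fps c = Abs_fps (\<lambda>n. real (ann_total c n))"

lemma cat_Suc_Suc: "cat (Suc (Suc n)) = (\<Sum>i\<le>n. cat i * cat (n - i))"
  by (simp add: cat.simps lessThan_Suc_atMost)

lemma cat_fps_eq: "cat_fps = fps_X\<^sup>2 + cat_fps\<^sup>2"
proof -
  let ?C = "Abs_fps (\<lambda>n. real (cat n))"
  have "?C = 1 + fps_X\<^sup>2 * (?C * ?C)"
  proof (rule fps_ext)
    fix n :: nat
    consider "n = 0" | "n = 1" | m where "n = Suc (Suc m)" by atomize_elim presburger
    then show "?C $ n = (1 + fps_X\<^sup>2 * (?C * ?C)) $ n"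
    proof cases
      case 3
      have "?C $ n = (?C * ?C) $ m" by (simp add: 3 cat_Suc_Suc fps_mult_nth atMost_atLeast0)
      then show ?thesis by (simp only: 3 fps_add_nth fps_X_power_mult_nth) simp
    qed (simp_all add: fps_X_power_mult_nth cat.simps)
  qed
  then have "fps_X\<^sup>2 * ?C = fps_X\<^sup>2 * (1 + fps_X\<^sup>2 * (?C * ?C))" by (rule arg_cong)
  also have "\<dots> = fps_X\<^sup>2 + (fps_X\<^sup>2 * ?C)\<^sup>2" by (simp add: algebra_simps power2_eq_square)
  finally show ?thesis by (simp only: cat_fps_def)
qed

lemma ann_fps_eq:
  "ann_fps c = fps_X\<^sup>2 * Abs_fps (\<lambda>n. real (cat n * half_total c n)) + 2 * cat_fps * ann_fps c"
proof (rule fps_ext)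
  fix n :: nat
  have 2: "2 * cat_fps * ann_fps c = fps_X\<^sup>2 * (fps_const 2 * (Abs_fps (\<lambda>n. real (cat n)) * ann_fps c))"
    by (simp add: cat_fps_def ac_simps numeral_fps_const)
  consider "n = 0" | "n = 1" | m where "n = m + 2" by atomize_elim presburger
  then show "ann_fps c $ n =
      (fps_X\<^sup>2 * Abs_fps (\<lambda>n. real (cat n * half_total c n)) + 2 * cat_fps * ann_fps c) $ n"
  proof cases
    case 3
    have *: "ann_fps c $ n = real (cat m * half_total c m) + 2 * (\<Sum>i\<le>m. real (cat i) * real (ann_total c (m - i)))"
      unfolding ann_fps_def 3 fps_nth_Abs_fps ann_total_rec by simp
    have shift: "(fps_X\<^sup>2 * f) $ (m + 2) = f $ m" for f :: "real fps"
      by (simp only: fps_X_power_mult_nth) simp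
    have "(fps_const 2 * (Abs_fps (\<lambda>n. real (cat n)) * ann_fps c)) $ m =
        2 * (\<Sum>i\<le>m. real (cat i) * real (ann_total c (m - i)))"
      unfolding fps_mult_left_const_nth by (simp add: fps_mult_nth ann_fps_def atMost_atLeast0)
    then show ?thesis
      unfolding * unfolding 2 3 fps_add_nth shift by simp
  qed (simp_all add: 2 fps_X_power_mult_nth ann_fps_def ann_total_0 ann_total_1)
qed

lemma cat_fps_nth: "cat_fps $ n = (if n < 2 then 0 else real (cat (n - 2)))"
  by (simp add: cat_fps_def fps_X_power_mult_nth)

lemma half_total_False: "2 * half_total False n = (n + 1) * (n + 2)"
proof -
  have "2 * (\<Sum>k\<le>Suc n. k) = (n + 1) * (n + 2)" by (induction n) auto
  then show ?thesis by (simp add: half_total_def half_def del: sum.atMost_Suc)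
qed

lemma half_total_True:
  assumes "even n"
  shows "8 * half_total True n = n * (n + 2)"
proof -
  obtain m where m: "n = 2 * m" using assms by blast
  have "8 * (\<Sum>k\<le>Suc (2 * m). if even k then k div 2 else 0) = 2 * m * (2 * m + 2)"
    by (induction m) (auto simp: algebra_simps)
  then show ?thesis by (simp add: half_total_def half_def m del: sum.atMost_Suc cong: if_cong)
qed

text \<open>\<open>cat n\<close> is the coefficient of \<open>cat_fps\<close> at
  \<open>n + 2\<close>, so the factor (n + 2)(n + 1) from \<open>half_total_False\<close> is the
  effect of two derivatives.\<close>

lemma source_False:
  "2 * (fps_X\<^sup>2 * Abs_fps (\<lambda>n. real (cat n * half_total False n))) =
    fps_X\<^sup>2 * fps_deriv (fps_deriv cat_fps)"
proof -
  have "fps_const 2 * Abs_fps (\<lambda>n. real (cat n * half_total False n)) = fps_deriv (fps_deriv cat_fps)"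
  proof (rule fps_ext)
    fix n :: nat
    have "2 * real (half_total False n) = (real n + 1) * (real n + 2)"
      using half_total_False[of n] by (metis (mono_tags) of_nat_1 of_nat_add of_nat_mult of_nat_numeral)
    then show "(fps_const 2 * Abs_fps (\<lambda>n. real (cat n * half_total False n))) $ n = fps_deriv (fps_deriv cat_fps) $ n"
      by (simp add: cat_fps_nth algebra_simps)
  qed
  then show ?thesis by (simp add: numeral_fps_const mult.left_commute)
qed

text \<open>Now the factor is n (n + 2) = (n + 2)(n + 1) - (n + 2), whence the first derivative. The
  formula for \<open>half_total\<close> holds for even \<open>n\<close>; at odd \<open>n\<close> the
  coefficient \<open>cat n\<close> vanishes.\<close>

lemma source_True:
  "8 * (fps_X\<^sup>2 * Abs_fps (\<lambda>n. real (cat n * half_total True n))) =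
    fps_X\<^sup>2 * fps_deriv (fps_deriv cat_fps) - fps_X * fps_deriv cat_fps"
proof (rule fps_ext)
  fix n :: nat
  have 8: "8 * (fps_X\<^sup>2 * Abs_fps (\<lambda>n. real (cat n * half_total True n))) =
      fps_X\<^sup>2 * (fps_const 8 * Abs_fps (\<lambda>n. real (cat n * half_total True n)))"
    by (simp add: numeral_fps_const mult.left_commute)
  have half: "8 * (real (cat m) * real (half_total True m)) = real (cat m) * (real m * (real m + 2))" for m
  proof (cases "even m")
    case True
    then have "8 * real (half_total True m) = real m * (real m + 2)"
      using half_total_True[of m] by (metis (mono_tags) of_nat_add of_nat_mult of_nat_numeral)
    then show ?thesis by simp
  qed (simp add: cat_odd)
  consider "n = 0" | "n = 1" | m where "n = Suc (Suc m)" by atomize_elim presburger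
  then show "(8 * (fps_X\<^sup>2 * Abs_fps (\<lambda>n. real (cat n * half_total True n)))) $ n =
      (fps_X\<^sup>2 * fps_deriv (fps_deriv cat_fps) - fps_X * fps_deriv cat_fps) $ n"
  proof cases
    case 3
    then show ?thesis
      unfolding 8 fps_sub_nth fps_X_power_mult_nth using half[of m] by (simp add: cat_fps_nth algebra_simps)
  qed (simp_all add: 8 fps_X_power_mult_nth cat_fps_nth)
qed

text \<open>Differentiating Y = t^2 + Y^2 gives Y' S = 2 t, and differentiating again Y'' S = 2 + 2
  Y'^2. Multiplied by S^2, the latter becomes 2 S^2 + 8 t^2 = 2.\<close>

lemma cat_fps_facts:
  fixes Y Y1 Y2 S X :: "real fps"
  defines "Y \<equiv> cat_fps" and "Y1 \<equiv> fps_deriv cat_fps" and "Y2 \<equiv> fps_deriv (fps_deriv cat_fps)"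
    and "S \<equiv> 1 - 2 * cat_fps" and "X \<equiv> fps_X"
  shows "S\<^sup>2 = 1 - 4 * X\<^sup>2" "Y1 * S = 2 * X" "Y2 * S ^ 3 = 2"
proof -
  have Y: "Y = X\<^sup>2 + Y\<^sup>2" unfolding Y_def X_def by (rule cat_fps_eq)
  have S: "S = 1 - 2 * Y" by (simp add: S_def Y_def)
  show S2: "S\<^sup>2 = 1 - 4 * X\<^sup>2"
  proof -
    have "S\<^sup>2 = 1 - 4 * (Y - Y\<^sup>2)" unfolding S by (simp add: power2_eq_square algebra_simps)
    also have "Y - Y\<^sup>2 = X\<^sup>2" using Y by (simp add: algebra_simps)
    finally show ?thesis .
  qed
  have "fps_deriv Y = fps_deriv (X\<^sup>2 + Y\<^sup>2)" using Y by simp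
  then have "Y1 = 2 * X + 2 * Y * Y1"
    unfolding Y1_def Y_def X_def by (simp add: power2_eq_square algebra_simps)
  then show Y1: "Y1 * S = 2 * X" unfolding S by (simp add: algebra_simps)
  have "fps_deriv (Y1 * S) = fps_deriv (2 * X)" using Y1 by simp
  then have Y2: "Y2 * S = 2 + 2 * Y1\<^sup>2"
    unfolding Y1_def Y2_def X_def S_def by (simp add: power2_eq_square algebra_simps)
  have "Y2 * S ^ 3 = Y2 * S * S\<^sup>2" by (simp add: power2_eq_square power3_eq_cube)
  also have "\<dots> = 2 * S\<^sup>2 + 2 * (Y1 * S)\<^sup>2" unfolding Y2 by (simp add: power2_eq_square algebra_simps)
  also have "\<dots> = 2" unfolding Y1 S2 by (simp add: power2_eq_square algebra_simps)
  finally show "Y2 * S ^ 3 = 2" .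
qed

text \<open>The linear equation is \<open>ann_fps c * S = G c\<close>. Multiplying by
  \<open>S ^ 3\<close> gives S^4 = (1 - 4 t^2)^2 on the left and makes the right side polynomial: 2
  G S^3 = 2 t^2 without colors, and 8 G S^3 = 2 t^2 - 2 t^2 (1 - 4 t^2) = 8 t^4 with them.\<close>

lemma ann_fps_closed:
  "ann_fps False * (1 - 4 * fps_X\<^sup>2)\<^sup>2 = fps_X\<^sup>2"
  "ann_fps True * (1 - 4 * fps_X\<^sup>2)\<^sup>2 = fps_X ^ 4"
proof -
  define S where "S = 1 - 2 * cat_fps"
  define Y1 where "Y1 = fps_deriv cat_fps"
  define Y2 where "Y2 = fps_deriv (fps_deriv cat_fps)"
  define G where "G c = fps_X\<^sup>2 * Abs_fps (\<lambda>n. real (cat n * half_total c n))" for c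
  note facts = cat_fps_facts[folded S_def Y1_def Y2_def]
  have "ann_fps c * S = G c" for c
    using ann_fps_eq[of c] unfolding S_def G_def[symmetric] by (simp add: algebra_simps)
  moreover have "(1 - 4 * fps_X\<^sup>2)\<^sup>2 = S * S ^ 3"
    unfolding facts(1)[symmetric] by (simp flip: power_Suc power_mult)
  ultimately have F: "ann_fps c * (1 - 4 * fps_X\<^sup>2)\<^sup>2 = G c * S ^ 3" for c
    by (metis mult.assoc)
  have "2 * (G False * S ^ 3) = fps_X\<^sup>2 * (Y2 * S ^ 3)"
    using source_False unfolding G_def[symmetric] Y2_def[symmetric] by (metis mult.assoc)
  then show "ann_fps False * (1 - 4 * fps_X\<^sup>2)\<^sup>2 = fps_X\<^sup>2"
    unfolding F facts(3) by simp
  have "8 * (G True * S ^ 3) = 8 * G True * S ^ 3" by (simp only: mult.assoc)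
  also have "8 * G True = fps_X\<^sup>2 * Y2 - fps_X * Y1"
    using source_True unfolding G_def Y2_def Y1_def .
  also have "(fps_X\<^sup>2 * Y2 - fps_X * Y1) * S ^ 3 = fps_X\<^sup>2 * (Y2 * S ^ 3) - fps_X * (Y1 * S) * S\<^sup>2"
    by (simp add: algebra_simps power2_eq_square power3_eq_cube)
  also have "\<dots> = 8 * fps_X ^ 4"
    unfolding facts by (simp add: algebra_simps power2_eq_square power4_eq_xxxx)
  finally show "ann_fps True * (1 - 4 * fps_X\<^sup>2)\<^sup>2 = fps_X ^ 4"
    unfolding F by simp
qed

lemma ann_total_True: "ann_total True (n + 2) = ann_total False n"
proof -
  have ne: "(1 - 4 * fps_X\<^sup>2 :: real fps)\<^sup>2 \<noteq> 0"
  proof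
    assume "(1 - 4 * fps_X\<^sup>2 :: real fps)\<^sup>2 = 0"
    then show False using ann_fps_closed(1) by (simp only: mult_zero_right) simp
  qed
  have "ann_fps True * (1 - 4 * fps_X\<^sup>2)\<^sup>2 = (fps_X\<^sup>2 * ann_fps False) * (1 - 4 * fps_X\<^sup>2)\<^sup>2"
    using ann_fps_closed by (simp add: mult.assoc flip: power_add)
  then have "ann_fps True = fps_X\<^sup>2 * ann_fps False" using ne by simp
  then have "ann_fps True $ (n + 2) = ann_fps False $ n" by (simp add: fps_X_power_mult_nth)
  then show ?thesis by (simp add: ann_fps_def)
qed

text \<open>Expanding (1 - 4 t^2)^2 = 1 - 8 t^2 + 16 t^4 yields a linear recurrence of order two.
  The factor 4 on the left avoids the truncated exponent of \<open>4 ^ (n - 1)\<close> at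
  \<open>n = 0\<close>.\<close>

lemma ann_total_False: "4 * ann_total False (2 * n) = n * 4 ^ n"
proof -
  let ?F = "ann_fps False"
  have "?F = fps_X\<^sup>2 + fps_const 8 * (fps_X\<^sup>2 * ?F) - fps_const 16 * (fps_X ^ 4 * ?F)"
    using ann_fps_closed(1) by (simp add: numeral_fps_const[symmetric] algebra_simps power2_eq_square power4_eq_xxxx)
  then have rec: "?F $ m = (fps_X\<^sup>2 + fps_const 8 * (fps_X\<^sup>2 * ?F) - fps_const 16 * (fps_X ^ 4 * ?F)) $ m" for m
    by simp
  have "4 * ?F $ (2 * n) = real n * 4 ^ n"
  proof (induction n rule: less_induct)
    case (less n)
    consider "n = 0" | "n = 1" | m where "n = Suc (Suc m)" by atomize_elim presburger
    then show ?case
    proof cases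
      case 3
      have "?F $ (2 * n) = 8 * ?F $ (2 * Suc m) - 16 * ?F $ (2 * m)"
        by (subst rec) (simp add: 3 fps_X_power_mult_nth)
      then have "4 * ?F $ (2 * n) = 8 * (4 * ?F $ (2 * Suc m)) - 16 * (4 * ?F $ (2 * m))" by simp
      also have "\<dots> = real n * 4 ^ n"
        using less.IH[of "Suc m"] less.IH[of m] by (simp add: 3 algebra_simps)
      finally show ?thesis .
    next
      case 2
      then show ?thesis by (subst rec) (simp add: fps_X_power_mult_nth ann_fps_def ann_total_0)
    qed (simp add: ann_fps_def ann_total_0)
  qed
  then have "real (4 * ann_total False (2 * n)) = real (n * 4 ^ n)" by (simp add: ann_fps_def)
  then show ?thesis by (simp only: of_nat_eq_iff)
qed

section \<open>Gluings of two faces\<close>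

lemma cycle_of_list_upt:
  "cycle_of_list [a..<b] x = (if x \<in> {a..<b} then if Suc x = b then a else Suc x else x)"
proof (cases "x \<in> {a..<b}")
  case True
  define i where "i = x - a"
  have i: "i < length [a..<b]" "x = [a..<b] ! i" using True by (auto simp: i_def)
  have "map (cycle_of_list [a..<b] ^^ 1) [a..<b] = rotate 1 [a..<b]"
    by (rule cyclic_rotation) simp
  then have "map (cycle_of_list [a..<b]) [a..<b] = rotate1 [a..<b]" by (simp add: rotate_def)
  then have "cycle_of_list [a..<b] x = rotate1 [a..<b] ! i"
    using nth_map[OF i(1), of "cycle_of_list [a..<b]"] i(2) by simp
  also have "\<dots> = [a..<b] ! (Suc i mod (b - a))"
    using nth_rotate1[of i "[a..<b]"] i(1) by simp
  also have "\<dots> = (if Suc x = b then a else Suc x)"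
  proof (cases "Suc x = b")
    case True
    then have "Suc i = b - a" using \<open>x \<in> {a..<b}\<close> by (auto simp: i_def)
    then show ?thesis using True \<open>x \<in> {a..<b}\<close> by simp
  next
    case False
    then have "Suc i < b - a" using \<open>x \<in> {a..<b}\<close> by (auto simp: i_def)
    then show ?thesis using False \<open>x \<in> {a..<b}\<close> by (auto simp: i_def)
  qed
  finally show ?thesis using True by simp
qed (auto simp: id_outside_supp)

lemma orbit_interval:
  assumes step: "\<And>y. a \<le> y \<Longrightarrow> y < b \<Longrightarrow> f y = Suc y" and last: "f b = a" and y: "y \<in> {a..b}"
  shows "orbit f y = {a..b::nat}"
proof -
  have pow: "(f ^^ j) a = a + j" if "j \<le> b - a" for j
    using that by (induction j) (auto simp: step)
  have "(f ^^ Suc (b - a)) a = a" using pow[of "b - a"] last y by simp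
  then have "orbit f a = {(f ^^ m) a |m. m < Suc (b - a)}" by (rule orbit_altdef_bounded) simp
  also have "\<dots> = (\<lambda>m. a + m) ` {..b - a}"
    using pow by (auto simp: less_Suc_eq_le intro!: image_eqI) metis
  also have "\<dots> = {a..b}"
  proof safe
    fix z assume "z \<in> {a..b}"
    then show "z \<in> (\<lambda>m. a + m) ` {..b - a}" by (intro image_eqI[of _ _ "z - a"]) auto
  qed (use y in auto)
  finally have a: "orbit f a = {a..b}" .
  have "cyclic_on f {a..b}" using a y by (auto simp: cyclic_on_def)
  then show ?thesis using y by (rule orbit_cyclic_eq3)
qed

lemma face_perm_two:
  "face_perm [k, l] = cycle_of_list [1..<Suc k] \<circ> cycle_of_list [Suc k..<Suc (k + l)]"
  by (simp add: face_perm_def face_cycle_def psum_def)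

lemma face_perm_two_apply:
  "face_perm [k, l] y =
    (if y \<in> {1..k} then if y = k then 1 else Suc y
     else if y \<in> {Suc k..k + l} then if y = k + l then Suc k else Suc y else y)"
  unfolding face_perm_two comp_apply cycle_of_list_upt by auto

lemma face_perm_two_permutes: "face_perm [k, l] permutes {1..k + l}"
  unfolding face_perm_two
  by (intro permutes_compose permutes_subset[OF cycle_permutes]) auto

lemma orbit_face_perm_two:
  shows "y \<in> {1..k} \<Longrightarrow> orbit (face_perm [k, l]) y = {1..k}"
    and "y \<in> {Suc k..k + l} \<Longrightarrow> orbit (face_perm [k, l]) y = {Suc k..k + l}"
  by (rule orbit_interval; auto simp: face_perm_two_apply)+

lemma faces_distinct:
  assumes "0 < k"
  shows "{1..k} \<noteq> {Suc k..k + l}"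
proof
  assume eq: "{1..k} = {Suc k..k + l}"
  have "1 \<in> {1..k}" using assms by simp
  then show False unfolding eq using assms by simp
qed

lemma cycles_on_face_perm_two:
  assumes "0 < k" "0 < l"
  shows "cycles_on {1..k + l} (face_perm [k, l]) = {{1..k}, {Suc k..k + l}}"
proof -
  have "{1..k + l} = {1..k} \<union> {Suc k..k + l}" by auto
  moreover have "orbit (face_perm [k, l]) ` {1..k} = {{1..k}}"
    using assms orbit_face_perm_two(1) by (auto simp: image_def)
  moreover have "orbit (face_perm [k, l]) ` {Suc k..k + l} = {{Suc k..k + l}}"
    using assms orbit_face_perm_two(2) by (auto simp: image_def)
  ultimately show ?thesis unfolding cycles_on_def by (simp only: image_Un) auto
qed

lemma fpf_involution_iff: "fpf_involution n \<iota> \<longleftrightarrow> \<iota> \<in> pairings (edge_ok False \<chi>) {1..n}"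
proof
  assume "fpf_involution n \<iota>"
  then show "\<iota> \<in> pairings (edge_ok False \<chi>) {1..n}"
    by (auto simp: fpf_involution_def pairings_def edge_ok_def fun_eq_iff)
next
  assume \<iota>: "\<iota> \<in> pairings (edge_ok False \<chi>) {1..n}"
  have "\<iota> (\<iota> x) = x" for x
    using \<iota> pairings_outside[OF \<iota>, of x] by (cases "x \<in> {1..n}") (auto simp: pairings_def)
  then show "fpf_involution n \<iota>"
    using \<iota> by (auto simp: fpf_involution_def pairings_def fun_eq_iff)
qed

section \<open>Connectivity and genus for two faces\<close>

lemma generate_image_eq:
  assumes H: "H \<subseteq> carrier (sym_group n)" and F: "\<And>h. h \<in> H \<Longrightarrow> h ` F = F"
    and g: "g \<in> generate (sym_group n) H"
  shows "g ` F = F"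
  using g
proof induction
  case one
  then show ?case by (simp add: sym_group_one)
next
  case (incl h)
  then show ?case by (rule F)
next
  case (inv h)
  then have h: "h \<in> carrier (sym_group n)" using H by blast
  then have "inj h" by (auto simp: sym_group_carrier permutes_inj)
  then have "inv' h ` h ` F = F" by (simp add: image_comp)
  then show ?case using F[OF inv] h by simp
next
  case (eng h1 h2)
  then show ?case unfolding sym_group_mult image_comp[symmetric] by simp
qed

lemma generate_sym_group_comp:
  "g \<in> generate (sym_group n) H \<Longrightarrow> h \<in> generate (sym_group n) H \<Longrightarrow> g \<circ> h \<in> generate (sym_group n) H"
  using generate.eng[of g "sym_group n" H h] by (simp add: sym_group_mult)

lemma generate_sym_group_orbit:
  assumes h: "h \<in> H" and y: "y \<in> orbit h x"
  shows "\<exists>g\<in>generate (sym_group n) H. g x = y"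
proof -
  have pow: "h ^^ j \<in> generate (sym_group n) H" for j
  proof (induction j)
    case 0
    then show ?case using generate.one[of "sym_group n" H] by (simp add: sym_group_one id_def)
  next
    case (Suc j)
    then show ?case using generate_sym_group_comp[OF generate.incl[OF h] Suc] by (simp only: funpow.simps)
  qed
  obtain j where "y = (h ^^ j) x" using y by (auto simp: orbit_altdef)
  then show ?thesis by (intro bexI[OF _ pow[of j]]) simp
qed

text \<open>The faces are the cycles of the face permutation, so only the matching can lead from one
  to the other. Without such an edge the first face is invariant under both generators, hence under
  the group.\<close>

lemma connected_datum_two:
  assumes k: "0 < k" "0 < l" "k + l = 2 * N" and \<iota>: "\<iota> \<in> pairings R {1..k + l}"
  shows "connected_datum N [k, l] \<iota> \<longleftrightarrow> (\<exists>y\<in>{1..k}. \<iota> y \<in> {Suc k..k + l})"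
proof
  let ?\<tau> = "face_perm [k, l]" and ?F = "{1..k}" and ?G = "{Suc k..k + l}"
  let ?K = "generate (sym_group (2 * N)) {\<iota>, ?\<tau>}"
  have A: "{1..2 * N} = ?F \<union> ?G" using k by auto
  have \<iota>_perm: "\<iota> permutes {1..2 * N}" using \<iota> k by (simp add: pairings_def)
  have H: "{\<iota>, ?\<tau>} \<subseteq> carrier (sym_group (2 * N))"
    using \<iota>_perm face_perm_two_permutes[of k l] k by (simp add: sym_group_carrier)
  have invol: "\<iota> (\<iota> y) = y" if "y \<in> {1..k + l}" for y using \<iota> that by (auto simp: pairings_def)
  show "\<exists>y\<in>?F. \<iota> y \<in> ?G" if conn: "connected_datum N [k, l] \<iota>"
  proof (rule ccontr)
    assume no: "\<not> (\<exists>y\<in>?F. \<iota> y \<in> ?G)"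
    have \<iota>F: "\<iota> y \<in> ?F" if y: "y \<in> ?F" for y
    proof -
      have "\<iota> y \<in> {1..k + l}" using y by (intro pairings_mem[OF \<iota>]) simp
      moreover have "\<iota> y \<notin> ?G" using no y by blast
      ultimately show ?thesis by auto
    qed
    have "\<iota> ` ?F = ?F"
    proof
      show "?F \<subseteq> \<iota> ` ?F"
      proof
        fix y assume y: "y \<in> ?F"
        then have "y = \<iota> (\<iota> y)" using invol[of y] by simp
        then show "y \<in> \<iota> ` ?F" using \<iota>F[OF y] by (rule image_eqI)
      qed
    qed (use \<iota>F in blast)
    moreover have "?\<tau> ` ?F = ?F"
    proof -
      have "permutation ?\<tau>" using face_perm_two_permutes[of k l] by (auto simp: permutation_permutes)
      then have "bij_betw ?\<tau> (orbit ?\<tau> 1) (orbit ?\<tau> 1)" by (rule bij_betw_orbit)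
      then show ?thesis using orbit_face_perm_two(1)[of 1 k l] k by (simp add: bij_betw_def)
    qed
    ultimately have "h ` ?F = ?F" if "h \<in> {\<iota>, ?\<tau>}" for h using that by blast
    then have F: "g ` ?F = ?F" if "g \<in> ?K" for g by (rule generate_image_eq[OF H _ that])
    have "\<exists>g\<in>?K. g 1 = Suc k"
      by (rule conn[unfolded connected_datum_def, rule_format]) (use k in auto)
    then obtain g where g: "g \<in> ?K" "g 1 = Suc k" by (rule bexE)
    then have "Suc k \<in> g ` ?F" using k by (intro image_eqI[of _ g 1]) auto
    then show False unfolding F[OF g(1)] by simp
  qed
  show "connected_datum N [k, l] \<iota>" if ex: "\<exists>y\<in>?F. \<iota> y \<in> ?G"
  proof -
    define reach where "reach x y \<longleftrightarrow> (\<exists>g\<in>?K. g x = y)" for x y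
    have trans: "reach x z" if xy: "reach x y" and yz: "reach y z" for x y z
    proof -
      obtain g h where "g \<in> ?K" "g x = y" "h \<in> ?K" "h y = z" using xy yz unfolding reach_def by blast
      then show ?thesis unfolding reach_def by (intro bexI[of _ "h \<circ> g"] generate_sym_group_comp) simp_all
    qed
    have \<tau>: "reach x y" if "y \<in> orbit ?\<tau> x" for x y
      unfolding reach_def using that by (intro generate_sym_group_orbit[where h = ?\<tau>]) simp_all
    have \<iota>': "reach x (\<iota> x)" for x
      unfolding reach_def by (intro bexI[of _ \<iota>] generate.incl) simp_all
    have FF: "reach x y" if "x \<in> ?F" "y \<in> ?F" for x y
      using \<tau>[of y x] orbit_face_perm_two(1)[OF that(1), of l] that by simp
    have GG: "reach x y" if "x \<in> ?G" "y \<in> ?G" for x y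
      using \<tau>[of y x] orbit_face_perm_two(2)[OF that(1)] that by simp
    obtain u where u: "u \<in> ?F" "\<iota> u \<in> ?G" using ex by blast
    have back_u: "reach (\<iota> u) u" using \<iota>'[of "\<iota> u"] invol[of u] u by simp
    have all: "reach x y" if x: "x \<in> ?F \<union> ?G" and y: "y \<in> ?F \<union> ?G" for x y
    proof -
      have "reach x u" using x FF[OF _ u(1)] GG[OF _ u(2)] trans[OF _ back_u] by blast
      moreover have "reach u y" using y FF[OF u(1)] GG[OF u(2)] trans[OF \<iota>'] by blast
      ultimately show ?thesis by (rule trans)
    qed
    show ?thesis unfolding connected_datum_def A by (intro ballI all[unfolded reach_def])
  qed
qed

text \<open>Genus 0 with two faces asks for \<open>N\<close> cycles of the product, and the face
  permutation has two, so both sides in \<open>deficient\<close> become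
  \<open>N + 2\<close>.\<close>

lemma has_genus_two:
  assumes k: "0 < k" "0 < l" "k + l = 2 * N"
  shows "has_genus 0 N 2 [k, l] \<iota> \<longleftrightarrow> deficient {1..k + l} {1..k + l} (face_perm [k, l]) \<iota>"
proof -
  have "card (cycles_on {1..k + l} (face_perm [k, l])) = 2"
    unfolding cycles_on_face_perm_two[OF k(1,2)] card_2_iff
    by (intro exI conjI, rule refl, rule faces_distinct[OF k(1)])
  moreover have "num_cycles (2 * N) (face_perm [k, l] \<circ> \<iota>) =
      card (cycles_on {1..k + l} (face_perm [k, l] \<circ> \<iota>))"
    by (simp add: num_cycles_def cycles_on_def k(3))
  ultimately show ?thesis by (simp add: has_genus_def deficient_def k(3))
qed

lemma annular_two:
  assumes k: "0 < k" "0 < l" "k + l = 2 * N" and \<iota>: "\<iota> \<in> pairings R {1..k + l}"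
  shows "connected_datum N [k, l] \<iota> \<and> has_genus 0 N 2 [k, l] \<iota> \<longleftrightarrow>
    annular {1..k + l} {1..k + l} (face_perm [k, l]) {1..k} {Suc k..k + l} \<iota>"
  unfolding connected_datum_two[OF k \<iota>] has_genus_two[OF k] annular_def by blast

text \<open>At the start every label is matched, so \<open>D = A\<close>, and the coloring is the
  parity of the label. Even face sizes make it change also at the steps that close a face. There are
  no further cycles, so the product is empty.\<close>

lemma card_annular_two:
  assumes k: "0 < k" "0 < l" and c: "c \<longrightarrow> even k \<and> even l"
  shows "card {\<iota> \<in> pairings (edge_ok c even) {1..k + l}.
    annular {1..k + l} {1..k + l} (face_perm [k, l]) {1..k} {Suc k..k + l} \<iota>} = ann c k l"
proof -
  let ?A = "{1..k + l}"
  have "colored c even ?A ?A (face_perm [k, l])"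
    using c by (auto simp: colored_def face_perm_two_apply)
  then have "card {\<iota> \<in> pairings (edge_ok c even) ?A.
      annular ?A ?A (face_perm [k, l]) {1..k} {Suc k..k + l} \<iota>} =
    ann c (card (?A \<inter> {1..k})) (card (?A \<inter> {Suc k..k + l})) *
    (\<Prod>C\<in>cycles_on ?A (face_perm [k, l]) - {{1..k}, {Suc k..k + l}}. cat (card (?A \<inter> C)))"
    by (intro card_annular[OF face_perm_two_permutes] faces_distinct k(1))
      (unfold cycles_on_face_perm_two[OF k], simp_all)
  moreover have "?A \<inter> {1..k} = {1..k}" "?A \<inter> {Suc k..k + l} = {Suc k..k + l}" by auto
  ultimately show ?thesis unfolding cycles_on_face_perm_two[OF k] by simp
qed

lemma compositions_two: "compositions n 2 = (\<lambda>k. [k, n - k]) ` {1..<n}"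
proof
  show "compositions n 2 \<subseteq> (\<lambda>k. [k, n - k]) ` {1..<n}"
  proof
    fix ms assume ms: "ms \<in> compositions n 2"
    then obtain k l where "ms = [k, l]" by (auto simp: compositions_def numeral_2_eq_2 length_Suc_conv)
    with ms show "ms \<in> (\<lambda>k. [k, n - k]) ` {1..<n}" by (auto simp: compositions_def intro!: image_eqI[of _ _ k])
  qed
qed (auto simp: compositions_def)

lemma card_gluing_data_two:
  assumes "\<And>k. k \<in> {1..<2 * N} \<Longrightarrow>
    card {\<iota>. fpf_involution (2 * N) \<iota> \<and> P [k, 2 * N - k] \<iota>} = f k"
  shows "card {(ms, \<iota>). (ms, \<iota>) \<in> gluing_data N 2 \<and> P ms \<iota>} = sum f {1..<2 * N}"
proof -
  let ?I = "\<lambda>ms. {\<iota>. fpf_involution (2 * N) \<iota> \<and> P ms \<iota>}"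
  have fin: "finite (?I ms)" for ms
    by (rule finite_subset[OF _ finite_pairings[of "{1..2 * N}" "edge_ok False even"]])
      (auto simp: fpf_involution_iff[where \<chi> = even])
  have "{(ms, \<iota>). (ms, \<iota>) \<in> gluing_data N 2 \<and> P ms \<iota>} = Sigma (compositions (2 * N) 2) ?I"
    by (auto simp: gluing_data_def)
  then have "card {(ms, \<iota>). (ms, \<iota>) \<in> gluing_data N 2 \<and> P ms \<iota>} = (\<Sum>ms\<in>compositions (2 * N) 2. card (?I ms))"
    using fin by (simp add: compositions_two)
  also have "\<dots> = (\<Sum>k\<in>{1..<2 * N}. card (?I [k, 2 * N - k]))"
    unfolding compositions_two by (subst sum.reindex) (auto simp: inj_on_def)
  also have "\<dots> = sum f {1..<2 * N}" by (intro sum.cong refl assms)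
  finally show ?thesis .
qed

lemma ann_total_eq: "ann_total c (2 * N) = (\<Sum>k\<in>{1..<2 * N}. if c \<longrightarrow> even k then ann c k (2 * N - k) else 0)"
  unfolding ann_total_def
proof (rule sum.mono_neutral_cong_right)
  show "\<forall>k\<in>{..2 * N} - {1..<2 * N}. (if c \<longrightarrow> even k \<and> even (2 * N) then ann c k (2 * N - k) else 0) = 0"
  proof
    fix k assume "k \<in> {..2 * N} - {1..<2 * N}"
    then have "k = 0 \<or> 2 * N - k = 0" by auto
    then show "(if c \<longrightarrow> even k \<and> even (2 * N) then ann c k (2 * N - k) else 0) = 0"
      by (auto simp: ann_0_right)
  qed
qed auto

text \<open>For \<open>N = 0\<close> the left side is 0 by the convention for
  \<open>g + K > 1\<close>, in agreement with \<open>ann_total_0\<close>.\<close>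

lemma eps_two: "eps 0 N 2 = ann_total False (2 * N)"
proof (cases "N = 0")
  case False
  have "card {\<iota>. fpf_involution (2 * N) \<iota> \<and> connected_datum N [k, 2 * N - k] \<iota> \<and>
      has_genus 0 N 2 [k, 2 * N - k] \<iota>} = ann False k (2 * N - k)" if k: "k \<in> {1..<2 * N}" for k
  proof -
    define l where "l = 2 * N - k"
    have kl: "0 < k" "0 < l" "k + l = 2 * N" using k by (auto simp: l_def)
    have "{\<iota>. fpf_involution (2 * N) \<iota> \<and> connected_datum N [k, l] \<iota> \<and> has_genus 0 N 2 [k, l] \<iota>} =
        {\<iota> \<in> pairings (edge_ok False even) {1..k + l}.
          annular {1..k + l} {1..k + l} (face_perm [k, l]) {1..k} {Suc k..k + l} \<iota>}"
      using annular_two[OF kl] by (intro Collect_cong) (auto simp: fpf_involution_iff[where \<chi> = even] kl(3))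
    then show ?thesis using card_annular_two[OF kl(1,2), of False] by (simp add: l_def)
  qed
  then show ?thesis
    using False card_gluing_data_two[where P = "\<lambda>ms \<iota>. connected_datum N ms \<iota> \<and> has_genus 0 N 2 ms \<iota>"]
    by (simp add: eps_def ann_total_eq)
qed (simp add: eps_def ann_total_0)

section \<open>Bicolored data\<close>

text \<open>Labels of the second face are its positions shifted by \<open>k\<close>; for even
  \<open>k\<close>, position and label have the same parity, and the condition no longer refers to
  faces.\<close>

lemma bicolored_two:
  assumes k: "k + l = 2 * N" and perm: "\<iota> permutes {1..2 * N}"
  shows "bicolored [k, l] \<iota> \<longleftrightarrow> even k \<and> even l \<and> (\<forall>y\<in>{1..2 * N}. odd y \<longrightarrow> even (\<iota> y))"
proof -
  let ?ms = "[k, l]"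
  have psum: "psum ?ms 0 = 0" "psum ?ms (Suc 0) = k" by (simp_all add: psum_def)
  have all2: "(\<forall>i<length ?ms. Q i) \<longleftrightarrow> Q 0 \<and> Q (Suc 0)" and ex2: "(\<exists>i<length ?ms. Q i) \<longleftrightarrow> Q 0 \<or> Q (Suc 0)" for Q
    by (auto simp: less_Suc_eq)
  define T where "T z \<longleftrightarrow> (\<exists>j<length ?ms. \<exists>r'\<in>{1..?ms ! j}. even r' \<and> z = psum ?ms j + r')" for z
  have bic: "bicolored ?ms \<iota> \<longleftrightarrow> even k \<and> even l \<and>
      (\<forall>r\<in>{1..k}. odd r \<longrightarrow> T (\<iota> r)) \<and> (\<forall>r\<in>{1..l}. odd r \<longrightarrow> T (\<iota> (k + r)))"
    unfolding bicolored_def T_def[symmetric] all2 psum by simp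
  have T: "T (\<iota> y) \<longleftrightarrow> even (\<iota> y)" if ev: "even k" and y: "y \<in> {1..2 * N}" for y
  proof -
    have z: "\<iota> y \<in> {1..2 * N}" using permutes_in_image[OF perm] y by simp
    show ?thesis
    proof (cases "\<iota> y \<le> k")
      case True
      then have "even (\<iota> y) \<longrightarrow> T (\<iota> y)" unfolding T_def ex2 psum using z by simp
      moreover have "even (\<iota> y)" if "T (\<iota> y)" using that ev unfolding T_def ex2 psum by auto
      ultimately show ?thesis by blast
    next
      case False
      then have "\<iota> y - k \<in> {1..l}" "\<iota> y = k + (\<iota> y - k)" using z k by auto
      then have "even (\<iota> y) \<longrightarrow> T (\<iota> y)" unfolding T_def ex2 psum using ev by (auto intro!: bexI[of _ "\<iota> y - k"])
      moreover have "even (\<iota> y)" if "T (\<iota> y)" using that ev unfolding T_def ex2 psum by auto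
      ultimately show ?thesis by blast
    qed
  qed
  show ?thesis
  proof (cases "even k \<and> even l")
    case True
    then have ev: "even k" by simp
    have "(\<forall>r\<in>{1..k}. odd r \<longrightarrow> T (\<iota> r)) \<and> (\<forall>r\<in>{1..l}. odd r \<longrightarrow> T (\<iota> (k + r))) \<longleftrightarrow>
        (\<forall>y\<in>{1..2 * N}. odd y \<longrightarrow> even (\<iota> y))" (is "?P \<longleftrightarrow> ?Q")
    proof
      assume P: ?P
      show ?Q
      proof (intro ballI impI)
        fix y assume y: "y \<in> {1..2 * N}" "odd y"
        have "T (\<iota> y)"
        proof (cases "y \<le> k")
          case True
          then show ?thesis using P y by simp
        next
          case False
          then have "y - k \<in> {1..l}" "odd (y - k)" "k + (y - k) = y" using y k ev by auto
          then show ?thesis using P[THEN conjunct2, rule_format, of "y - k"] by simp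
        qed
        then show "even (\<iota> y)" using T[OF ev y(1)] by simp
      qed
    next
      assume Q: ?Q
      have "T (\<iota> y)" if "y \<in> {1..2 * N}" "odd y" for y
        using Q that T[OF ev that(1)] by blast
      then show ?P using k ev by simp
    qed
    then show ?thesis using True bic by blast
  qed (use bic in blast)
qed

text \<open>Bicoloring constrains odd labels only. There are as many odd labels as even ones, so the
  odd ones are mapped onto the even ones, and the involution sends these back.\<close>

lemma odd_to_even_imp_alternating:
  fixes N :: nat
  assumes \<iota>: "\<iota> \<in> pairings R {1..2 * N}" and odd: "\<forall>y\<in>{1..2 * N}. odd y \<longrightarrow> even (\<iota> y)"
    and y: "y \<in> {1..2 * N}"
  shows "even y \<noteq> even (\<iota> y)"
proof (cases "odd y")
  case False
  let ?O = "{y \<in> {1..2 * N}. odd y}" and ?E = "{y \<in> {1..2 * N}. even y}"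
  have perm: "\<iota> permutes {1..2 * N}" using \<iota> by (simp add: pairings_def)
  have "bij_betw Suc ?O ?E"
  proof (rule bij_betw_byWitness[where f' = "\<lambda>n. n - 1"])
    have "Suc y \<le> 2 * N" if "y \<le> 2 * N" "odd y" for y using that by presburger
    then show "Suc ` ?O \<subseteq> ?E" by auto
    have "odd (y - Suc 0)" "Suc 0 \<le> y - Suc 0" if "Suc 0 \<le> y" "even y" for y :: nat
      using that by presburger+
    then show "(\<lambda>n. n - 1) ` ?E \<subseteq> ?O" by auto
  qed auto
  then have "card ?O = card ?E" by (rule bij_betw_same_card)
  moreover have "\<iota> ` ?O \<subseteq> ?E" using odd pairings_mem[OF \<iota>] by auto
  moreover have "card (\<iota> ` ?O) = card ?O"
    using permutes_inj[OF perm] by (intro card_image) (auto intro: inj_on_subset)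
  ultimately have "\<iota> ` ?O = ?E" by (intro card_subset_eq) auto
  then obtain z where z: "z \<in> ?O" "y = \<iota> z" using y False by blast
  then have "\<iota> y = z" using \<iota> by (auto simp: pairings_def)
  then show ?thesis using z False by simp
qed (use odd y in auto)

lemma bicolored_count_two: "bicolored_count 0 N 2 = ann_total True (2 * N)"
proof -
  have "card {\<iota>. fpf_involution (2 * N) \<iota> \<and> connected_datum N [k, 2 * N - k] \<iota> \<and>
      has_genus 0 N 2 [k, 2 * N - k] \<iota> \<and> bicolored [k, 2 * N - k] \<iota>} =
      (if even k then ann True k (2 * N - k) else 0)" if k: "k \<in> {1..<2 * N}" for k
  proof -
    define l where "l = 2 * N - k"
    have kl: "0 < k" "0 < l" "k + l = 2 * N" using k by (auto simp: l_def)
    show ?thesis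
    proof (cases "even k")
      case True
      then have even: "even l" using kl(3) by presburger
      have "fpf_involution (2 * N) \<iota> \<and> bicolored [k, l] \<iota> \<longleftrightarrow> \<iota> \<in> pairings (edge_ok True even) {1..k + l}" for \<iota>
      proof
        assume "fpf_involution (2 * N) \<iota> \<and> bicolored [k, l] \<iota>"
        then have \<iota>: "\<iota> \<in> pairings (edge_ok False even) {1..2 * N}" and b: "bicolored [k, l] \<iota>"
          by (simp_all add: fpf_involution_iff[where \<chi> = even])
        then have "\<forall>y\<in>{1..2 * N}. odd y \<longrightarrow> even (\<iota> y)"
          using bicolored_two[OF kl(3)] by (simp add: pairings_def)
        then show "\<iota> \<in> pairings (edge_ok True even) {1..k + l}"
          using odd_to_even_imp_alternating[OF \<iota>] \<iota> unfolding kl(3) by (simp add: pairings_def edge_ok_def)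
      next
        assume "\<iota> \<in> pairings (edge_ok True even) {1..k + l}"
        then have \<iota>: "\<iota> permutes {1..2 * N}"
          "\<And>y. y \<in> {1..2 * N} \<Longrightarrow> \<iota> (\<iota> y) = y \<and> \<iota> y \<noteq> y \<and> (even y \<longleftrightarrow> odd (\<iota> y))"
          unfolding kl(3) pairings_def edge_ok_def by auto
        have "\<iota> \<in> pairings (edge_ok False even) {1..2 * N}"
          unfolding pairings_def edge_ok_def using \<iota> by blast
        moreover have "bicolored [k, l] \<iota>"
          unfolding bicolored_two[OF kl(3) \<iota>(1)] using True even \<iota>(2) by blast
        ultimately show "fpf_involution (2 * N) \<iota> \<and> bicolored [k, l] \<iota>"
          unfolding fpf_involution_iff[where \<chi> = even] by blast
      qed
      then have "{\<iota>. fpf_involution (2 * N) \<iota> \<and> connected_datum N [k, l] \<iota> \<and> has_genus 0 N 2 [k, l] \<iota> \<and>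
          bicolored [k, l] \<iota>} = {\<iota> \<in> pairings (edge_ok True even) {1..k + l}.
          annular {1..k + l} {1..k + l} (face_perm [k, l]) {1..k} {Suc k..k + l} \<iota>}"
        using annular_two[OF kl] by (intro Collect_cong) blast
      then show ?thesis using card_annular_two[OF kl(1,2), of True] True even by (simp add: l_def)
    next
      case False
      then have "\<not> bicolored [k, l] \<iota>" for \<iota> by (simp add: bicolored_def)
      then show ?thesis using False by (simp add: l_def)
    qed
  qed
  then show ?thesis
    using card_gluing_data_two[where P = "\<lambda>ms \<iota>. connected_datum N ms \<iota> \<and> has_genus 0 N 2 ms \<iota> \<and> bicolored ms \<iota>"]
    by (simp add: bicolored_count_def ann_total_eq)
qed

theorem theorem4:
  fixes N :: nat
  assumes "N \<ge> 1"
  shows "bicolored_count 0 N 2 = eps 0 (N - 1) 2 \<and> eps 0 (N - 1) 2 = (N - 1) * 4 ^ (N - 2)"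
proof -
  obtain n where N: "N = Suc n" using assms by (cases N) auto
  have "bicolored_count 0 N 2 = ann_total True (2 * n + 2)" by (simp add: bicolored_count_two N)
  also have "\<dots> = eps 0 n 2" by (simp only: ann_total_True eps_two)
  finally have "bicolored_count 0 N 2 = eps 0 (N - 1) 2" by (simp add: N)
  \<comment> \<open>The exponent \<open>N - 2\<close> is \<open>n - 1\<close>; for
    \<open>n = 0\<close> its truncation is harmless, as the factor \<open>n\<close>
    vanishes.\<close>
  moreover have "eps 0 n 2 = n * 4 ^ (n - 1)"
    using ann_total_False[of n] by (cases n) (simp_all add: eps_two)
  ultimately show ?thesis by (simp add: N)
qed

end
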